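(* Let $\alpha>0$ be a real number, let $m\ge 1$, let $U\subset(0,1)^m$ be open, and let $f:U\to\mathbb{R}$ be an analytic-bounded-monomial (a-b-m) function, $f(x)=b_j(x)F(b(x))$, such that all first order partial derivatives of (the components of) its associated bounded-monomial map $b$ are bounded on $U$. Let $$P:(0,1)^m\to(0,1)^m:\ (x_1,\ldots,x_m)\mapsto(P_\alpha(x_1),\ldots,P_\alpha(x_m)),\qquad P_\alpha(x)=\exp(1-x^{-\alpha}).$$ Then $f\circ P:P^{-1}(U)\to\mathbb{R}$ is $1/\alpha$-mild.
   Context: For $x\in(0,1)^m$ and $\mu\in\mathbb{R}^m$ write $x^\mu=\prod_{i=1}^m x_i^{\mu_i}$. Bounded-monomial maps: for $U\subset(0,1)^m$ open, a map $b:U\to\mathbb{R}$ is bounded-monomial if it is either identically zero, or of the form $b(x)=x^\mu$ for some $\mu\in\mathbb{R}^m$ and its image is bounded. A map $b:U\to\mathbb{R}^n$ is bounded-monomial if all its component functions are. A-b-m functions: a map $f:U\to\mathbb{R}$ is analytic-bounded-monomial (a-b-m) if it has the form $f(x)=b_j(x)F(b(x))$, where $b:U\to\mathbb{R}^n$ is a bounded-monomial map (the associated bounded-monomial map of $f$), $b_j$ is a component function of $b$, and $F$ is a unit on $\mathrm{Im}(b)$, i.e. $F$ is a real-valued function that is analytic and non-vanishing on an open neighborhood of the topological closure of $\mathrm{Im}(b)$ in $\mathbb{R}^n$. Mild functions: for $V\subset(0,1)^m$ open, $g\in C^\infty(V,\mathbb{R})$, $A,B\in\mathbb{R}_{>0}$,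 $C\in\mathbb{R}_{\ge0}$, the function $g$ is $(A,B,C)$-mild if $|g^{(\nu)}(x)|\le B A^{|\nu|}(|\nu|!)^{C+1}$ for all $x\in V$ and $\nu\in\mathbb{N}^m$ (with $0\in\mathbb{N}$), where $|\nu|=\nu_1+\cdots+\nu_m$ and $g^{(\nu)}=\frac{\partial^{|\nu|}g}{\partial x_1^{\nu_1}\cdots\partial x_m^{\nu_m}}$. It is $C$-mild if it is $(A,B,C)$-mild for some $A,B>0$. *)

theory Defs
  imports "HOL-Analysis.Analysis"
begin

definition unit_cube :: "(real ^ 'm) set" where
  "unit_cube = {x. \<forall>i. 0 < x $ i \<and> x $ i < 1}"

definition monomial :: "real ^ 'm \<Rightarrow> real ^ 'm \<Rightarrow> real" where
  "monomial \<mu> x = (\<Prod>i\<in>UNIV. x $ i powr \<mu> $ i)"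

text \<open>
  Maps on an open set \<open>U\<close> are represented by total functions; all notions below depend only on the
  values on \<open>U\<close> (derivatives at points of \<open>U\<close> are determined by these because \<open>U\<close> is open).
\<close>

definition bounded_monomial :: "(real ^ 'm) set \<Rightarrow> (real ^ 'm \<Rightarrow> real) \<Rightarrow> bool" where
  "bounded_monomial U b \<longleftrightarrow>
     (\<forall>x\<in>U. b x = 0) \<or>
     (\<exists>\<mu>. \<forall>x\<in>U. b x = monomial \<mu> x) \<and> bounded (b ` U)"

definition bounded_monomial_map ::
    "(real ^ 'm) set \<Rightarrow> (real ^ 'm \<Rightarrow> real ^ 'n) \<Rightarrow> bool" where
  "bounded_monomial_map U b \<longleftrightarrow> (\<forall>k. bounded_monomial U (\<lambda>x. b x $ k))"

text \<open>
  Real analyticity in several variables: near each point of \<open>W\<close> the function is the sum of a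
  (necessarily absolutely) convergent power series indexed by multi-indices \<open>'n \<Rightarrow> nat\<close>.
\<close>

definition real_analytic_on :: "(real ^ 'n \<Rightarrow> real) \<Rightarrow> (real ^ 'n) set \<Rightarrow> bool" where
  "real_analytic_on F W \<longleftrightarrow>
     (\<forall>a\<in>W. \<exists>r>0. \<exists>c :: ('n \<Rightarrow> nat) \<Rightarrow> real. \<forall>y\<in>ball a r.
        ((\<lambda>\<nu>. c \<nu> * (\<Prod>i\<in>UNIV. (y $ i - a $ i) ^ \<nu> i)) has_sum F y) UNIV)"

definition unit_on :: "(real ^ 'n \<Rightarrow> real) \<Rightarrow> (real ^ 'n) set \<Rightarrow> bool" where
  "unit_on F S \<longleftrightarrow>
     (\<exists>W. open W \<and> closure S \<subseteq> W \<and> real_analytic_on F W \<and> (\<forall>y\<in>W. F y \<noteq> 0))"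

text \<open>\<open>f\<close> is analytic-bounded-monomial on \<open>U\<close> with associated bounded-monomial map \<open>b\<close>.\<close>

definition abm :: "(real ^ 'm) set \<Rightarrow> (real ^ 'm \<Rightarrow> real ^ 'n) \<Rightarrow> (real ^ 'm \<Rightarrow> real) \<Rightarrow> bool" where
  "abm U b f \<longleftrightarrow>
     bounded_monomial_map U b \<and>
     (\<exists>j F. unit_on F (b ` U) \<and> (\<forall>x\<in>U. f x = b x $ j * F (b x)))"

definition partial_deriv :: "'m \<Rightarrow> (real ^ 'm \<Rightarrow> real) \<Rightarrow> real ^ 'm \<Rightarrow> real" where
  "partial_deriv i g x = deriv (\<lambda>t. g (x + t *\<^sub>R axis i 1)) 0"

definition iter_partial :: "'m list \<Rightarrow> (real ^ 'm \<Rightarrow> real) \<Rightarrow> real ^ 'm \<Rightarrow> real" where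
  "iter_partial is g = foldr partial_deriv is g"

definition smooth_on :: "(real ^ 'm) set \<Rightarrow> (real ^ 'm \<Rightarrow> real) \<Rightarrow> bool" where
  "smooth_on V g \<longleftrightarrow>
     (\<forall>is. continuous_on V (iter_partial is g) \<and>
       (\<forall>i. \<forall>x\<in>V. (\<lambda>t. iter_partial is g (x + t *\<^sub>R axis i 1)) differentiable (at 0)))"

text \<open>
  The index type carries no order, so the derivative for the multi-index \<open>\<nu>\<close> is taken along some
  list of directions in which each \<open>i\<close> occurs exactly \<open>\<nu> i\<close> times. For functions smooth on an open
  set the order of differentiation is irrelevant there, by symmetry of mixed partial derivatives.
\<close>

lemma ex_direction_list:
  fixes \<nu> :: "'m::finite \<Rightarrow> nat"
  shows "\<exists>is. \<forall>i. count_list is i = \<nu> i"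
proof -
  obtain xs where "mset xs = (\<Sum>i\<in>UNIV. replicate_mset (\<nu> i) i)"
    using ex_mset by blast
  then have "count_list xs i = \<nu> i" for i
    by (simp add: count_sum flip: count_mset)
  then show ?thesis by blast
qed

definition multi_deriv :: "('m \<Rightarrow> nat) \<Rightarrow> (real ^ 'm \<Rightarrow> real) \<Rightarrow> real ^ 'm \<Rightarrow> real" where
  "multi_deriv \<nu> g = iter_partial (SOME is. \<forall>i. count_list is i = \<nu> i) g"

definition mild ::
    "real \<Rightarrow> real \<Rightarrow> real \<Rightarrow> (real ^ 'm) set \<Rightarrow> (real ^ 'm \<Rightarrow> real) \<Rightarrow> bool" where
  "mild A B C V g \<longleftrightarrow>
     open V \<and> V \<subseteq> unit_cube \<and> A > 0 \<and> B > 0 \<and> C \<ge> 0 \<and> smooth_on V g \<and>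
     (\<forall>x\<in>V. \<forall>\<nu> :: 'm \<Rightarrow> nat.
        \<bar>multi_deriv \<nu> g x\<bar> \<le> B * A ^ (\<Sum>i\<in>UNIV. \<nu> i) * fact (\<Sum>i\<in>UNIV. \<nu> i) powr (C + 1))"

definition C_mild :: "real \<Rightarrow> (real ^ 'm) set \<Rightarrow> (real ^ 'm \<Rightarrow> real) \<Rightarrow> bool" where
  "C_mild C V g \<longleftrightarrow> (\<exists>A>0. \<exists>B>0. mild A B C V g)"

definition P1 :: "real \<Rightarrow> real \<Rightarrow> real" where
  "P1 \<alpha> x = exp (1 - x powr (- \<alpha>))"

text \<open>Only the restriction of \<open>P_map \<alpha>\<close> to \<open>unit_cube\<close> is meaningful.\<close>

definition P_map :: "real \<Rightarrow> real ^ 'm \<Rightarrow> real ^ 'm" where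
  "P_map \<alpha> x = (\<chi> i. P1 \<alpha> (x $ i))"

end

theory Submission
  imports Defs
begin

text \<open>
  On \<open>V = P\<^sup>-\<^sup>1(U)\<close> the function \<open>f \<circ> P\<close> is \<open>(b\<^sub>j \<circ> P) \<cdot> F(b \<circ> P)\<close>. Functions whose \<open>n\<close>-th order
  derivatives are bounded by \<open>B A\<^sup>n n!\<^sup>C\<^sup>+\<^sup>1\<close> form a Gevrey class that is closed under products
  (\<open>jet_bound_mult_gevrey\<close>) and under composition with an analytic function
  (\<open>jet_bound_compose_analytic\<close>), because \<open>C \<ge> 0\<close>. On the compact closure of the image of \<open>b\<close> the
  derivatives of \<open>F\<close> of order \<open>p\<close> are bounded by \<open>K L\<^sup>p p!\<close> (\<open>real_analytic_on_compact_jets\<close>). So it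
  suffices to bound the derivatives of each component \<open>b\<^sub>k \<circ> P\<close> with \<open>C = 1/\<alpha>\<close>
  (\<open>jet_bound_bounded_monomial\<close>).

  A nonzero component is \<open>h(x) = \<Prod>\<^sub>i exp(\<mu>\<^sub>i (1 - u\<^sub>i))\<close> with \<open>u\<^sub>i = x\<^sub>i powr -\<alpha>\<close>. Differentiating the
  \<open>i\<close>-th factor \<open>n\<close> times multiplies it by a sum of powers of \<open>x\<^sub>i\<close>, which for every \<open>\<delta> > 0\<close> is at most
  \<open>D\<^sup>n n! x\<^sub>i\<^sup>-\<^sup>n exp(\<delta> u\<^sub>i)\<close> with \<open>D\<close> depending on \<open>\<delta>\<close> and \<open>\<mu>\<close> (\<open>flat_factor_bound\<close>); and \<open>x\<^sub>i\<^sup>-\<^sup>n\<close> is at most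
  \<open>R\<^sup>n n! powr (1/\<alpha>) exp(\<delta> u\<^sub>i)\<close> since \<open>u\<^sup>n \<le> n! e\<^sup>u\<close>. Hence the Gevrey exponent \<open>1 + 1/\<alpha>\<close> appears as soon
  as \<open>h\<close> absorbs the factors \<open>exp(2\<delta> u\<^sub>i)\<close>. This is where the bounded first derivatives enter: they
  give \<open>\<bar>\<mu>\<^sub>i\<bar> y\<^sup>\<mu> \<le> const \<cdot> y\<^sub>i\<close> on \<open>U\<close>, that is \<open>h(x) \<le> M exp(-u\<^sub>i)\<close> for each \<open>i\<close> with \<open>\<mu>\<^sub>i \<noteq> 0\<close>.
  Together with \<open>h \<le> M\<close> for the other indices these are \<open>m\<close> inequalities, and their geometric mean
  bounds \<open>h\<close> by \<open>M\<close> times the product of \<open>exp(-u\<^sub>i / m)\<close> over the \<open>i\<close> with \<open>\<mu>\<^sub>i \<noteq> 0\<close>; so \<open>\<delta> = 1/(2m)\<close>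
  works. Coordinates with \<open>\<mu>\<^sub>i = 0\<close> do not occur in \<open>h\<close>, and derivatives in them vanish.
\<close>

section \<open>Partial derivatives and bounds on all of them\<close>

lemma partial_deriv_eqI:
  assumes "(g has_derivative D) (at x)"
  shows "partial_deriv i g x = D (axis i 1)"
proof -
  have line: "((\<lambda>t::real. x + t *\<^sub>R axis i 1) has_derivative (\<lambda>t. t *\<^sub>R axis i 1)) (at 0)"
    by (auto intro!: derivative_eq_intros)
  have "((\<lambda>t::real. g (x + t *\<^sub>R axis i 1)) has_derivative (\<lambda>t. D (t *\<^sub>R axis i 1))) (at 0)"
    by (rule has_derivative_compose[OF line]) (use assms in simp)
  moreover have "D (t *\<^sub>R axis i 1) = D (axis i 1) * t" for t
    using linear_simps(5)[OF has_derivative_bounded_linear[OF assms]] by simp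
  ultimately have "((\<lambda>t::real. g (x + t *\<^sub>R axis i 1)) has_field_derivative D (axis i 1)) (at 0)"
    by (simp add: has_field_derivative_def)
  then show ?thesis
    unfolding partial_deriv_def by (rule DERIV_imp_deriv)
qed

lemma partial_deriv_cong:
  assumes "open V" and "x \<in> V" and "\<And>y. y \<in> V \<Longrightarrow> g y = h y"
  shows "partial_deriv i g x = partial_deriv i h x"
  unfolding partial_deriv_def
proof (rule deriv_cong_ev[OF _ refl])
  have "((\<lambda>t::real. x + t *\<^sub>R axis i 1) \<longlongrightarrow> x + 0 *\<^sub>R axis i 1) (nhds 0)"
    by (intro tendsto_intros filterlim_ident)
  then have "\<forall>\<^sub>F t in nhds (0::real). x + t *\<^sub>R axis i 1 \<in> V"
    using assms(1,2) by (intro topological_tendstoD) auto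
  then show "\<forall>\<^sub>F t in nhds (0::real). g (x + t *\<^sub>R axis i 1) = h (x + t *\<^sub>R axis i 1)"
    by eventually_elim (rule assms(3))
qed

lemma iter_partial_simps:
  "iter_partial [] g = g"
  "iter_partial (i # is) g = partial_deriv i (iter_partial is g)"
  "iter_partial (is @ [i]) g = iter_partial is (partial_deriv i g)"
  by (simp_all add: iter_partial_def)

lemma iter_partial_cong:
  assumes "open V" and "\<And>y. y \<in> V \<Longrightarrow> g y = h y" and "x \<in> V"
  shows "iter_partial is g x = iter_partial is h x"
  using assms(3)
proof (induction "is" arbitrary: x)
  case (Cons i "is")
  then show ?case
    unfolding iter_partial_simps by (intro partial_deriv_cong[OF assms(1)]) auto
qed (simp add: iter_partial_simps assms(2))

text \<open>
  Derivatives are indexed by lists of directions, so that a derivative in one more direction is a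
  longer list. The cut-off \<open>N\<close> makes induction on the order possible: by \<open>jet_bound_Suc\<close> a bound up to order \<open>Suc N\<close> is a bound on the value together
  with bounds up to order \<open>N\<close> for the first partial derivatives. Total differentiability is
  required, rather than that of the restrictions to coordinate lines, so that the chain rule applies.
\<close>

definition jet_bound ::
    "(real ^ 'm) set \<Rightarrow> nat \<Rightarrow> (real ^ 'm \<Rightarrow> real) \<Rightarrow> (nat \<Rightarrow> real) \<Rightarrow> bool" where
  "jet_bound V N g \<beta> \<longleftrightarrow>
     (\<forall>is. length is \<le> N \<longrightarrow> (\<forall>x\<in>V. iter_partial is g differentiable (at x) \<and>
        \<bar>iter_partial is g x\<bar> \<le> \<beta> (length is)))"

lemma jet_bound_mono:
  assumes "jet_bound V N g \<beta>" and "N' \<le> N" and "\<And>n. n \<le> N' \<Longrightarrow> \<beta> n \<le> \<gamma> n"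
  shows "jet_bound V N' g \<gamma>"
  using assms unfolding jet_bound_def by (meson order_trans)

lemma jet_bound_cong:
  fixes V :: "(real ^ 'm) set"
  assumes "open V" and "\<And>y. y \<in> V \<Longrightarrow> g y = h y" and "jet_bound V N h \<beta>"
  shows "jet_bound V N g \<beta>"
  unfolding jet_bound_def
proof (intro allI impI ballI)
  fix "is" :: "'m list" and x assume l: "length is \<le> N" and x: "x \<in> V"
  have eq: "iter_partial is h y = iter_partial is g y" if "y \<in> V" for y
    using iter_partial_cong[OF assms(1) _ that, of g h] assms(2) by metis
  obtain D where "(iter_partial is h has_derivative D) (at x)"
    using assms(3) l x unfolding jet_bound_def differentiable_def by blast
  then have "(iter_partial is g has_derivative D) (at x)"
    using assms(1) x eq by (rule has_derivative_transform_within_open)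
  then show "iter_partial is g differentiable (at x) \<and> \<bar>iter_partial is g x\<bar> \<le> \<beta> (length is)"
    using assms(3) l x eq[OF x] unfolding jet_bound_def differentiable_def by metis
qed

lemma jet_bound_0:
  "jet_bound V 0 g \<beta> \<longleftrightarrow> (\<forall>x\<in>V. g differentiable (at x) \<and> \<bar>g x\<bar> \<le> \<beta> 0)"
  by (simp add: jet_bound_def iter_partial_simps)

lemma jet_bound_Suc:
  "jet_bound V (Suc N) g \<beta> \<longleftrightarrow>
     (\<forall>x\<in>V. g differentiable (at x) \<and> \<bar>g x\<bar> \<le> \<beta> 0) \<and>
     (\<forall>i. jet_bound V N (partial_deriv i g) (\<lambda>n. \<beta> (Suc n)))"
proof (intro iffI conjI allI)
  assume *: "jet_bound V (Suc N) g \<beta>"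
  show "\<forall>x\<in>V. g differentiable (at x) \<and> \<bar>g x\<bar> \<le> \<beta> 0"
    using jet_bound_mono[OF *, of 0 \<beta>] by (simp add: jet_bound_0)
  show "jet_bound V N (partial_deriv i g) (\<lambda>n. \<beta> (Suc n))" for i
    unfolding jet_bound_def
  proof (intro allI impI)
    fix "is" :: "'a list" assume "length is \<le> N"
    then show "\<forall>x\<in>V. iter_partial is (partial_deriv i g) differentiable (at x) \<and>
        \<bar>iter_partial is (partial_deriv i g) x\<bar> \<le> \<beta> (Suc (length is))"
      using *[unfolded jet_bound_def, rule_format, of "is @ [i]"]
      by (simp add: iter_partial_simps)
  qed
next
  assume *: "(\<forall>x\<in>V. g differentiable (at x) \<and> \<bar>g x\<bar> \<le> \<beta> 0) \<and>
     (\<forall>i. jet_bound V N (partial_deriv i g) (\<lambda>n. \<beta> (Suc n)))"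
  show "jet_bound V (Suc N) g \<beta>"
    unfolding jet_bound_def
  proof (intro allI impI)
    fix "is" :: "'a list" assume "length is \<le> Suc N"
    then show "\<forall>x\<in>V. iter_partial is g differentiable (at x) \<and>
        \<bar>iter_partial is g x\<bar> \<le> \<beta> (length is)"
      using * by (cases "is" rule: rev_cases) (auto simp: iter_partial_simps jet_bound_def)
  qed
qed

lemma jet_bound_add:
  assumes "open V" and "jet_bound V N g \<beta>" and "jet_bound V N h \<gamma>"
  shows "jet_bound V N (\<lambda>x. g x + h x) (\<lambda>n. \<beta> n + \<gamma> n)"
  using assms(2,3)
proof (induction N arbitrary: g h \<beta> \<gamma>)
  case 0
  have "\<bar>g x + h x\<bar> \<le> \<beta> 0 + \<gamma> 0" if "x \<in> V" for x
    using 0 that unfolding jet_bound_0 by (meson abs_triangle_ineq add_mono order_trans)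
  with 0 show ?case
    unfolding jet_bound_0 by (simp add: differentiable_add)
next
  case (Suc N)
  note gh = Suc.prems[unfolded jet_bound_Suc]
  have pd: "partial_deriv i (\<lambda>x. g x + h x) x = partial_deriv i g x + partial_deriv i h x"
    if "x \<in> V" for i x
  proof -
    obtain D E where D: "(g has_derivative D) (at x)" and E: "(h has_derivative E) (at x)"
      using gh \<open>x \<in> V\<close> unfolding differentiable_def by metis
    show ?thesis
      using partial_deriv_eqI[OF has_derivative_add[OF D E]]
      by (simp add: partial_deriv_eqI[OF D] partial_deriv_eqI[OF E])
  qed
  have "jet_bound V N (partial_deriv i (\<lambda>x. g x + h x)) (\<lambda>n. \<beta> (Suc n) + \<gamma> (Suc n))" for i
    by (rule jet_bound_cong[OF assms(1) pd Suc.IH]) (use gh in auto)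
  moreover have "\<bar>g x + h x\<bar> \<le> \<beta> 0 + \<gamma> 0" if "x \<in> V" for x
    using gh that by (meson abs_triangle_ineq add_mono order_trans)
  ultimately show ?case
    unfolding jet_bound_Suc using gh by (simp add: differentiable_add)
qed

lemma jet_bound_zero: "jet_bound V N (\<lambda>x. 0) (\<lambda>n. 0)"
proof -
  have "partial_deriv i (\<lambda>x. 0) = (\<lambda>x. 0)" for i :: 'a
    by (simp add: partial_deriv_def fun_eq_iff)
  then have "iter_partial is (\<lambda>x. 0) = (\<lambda>x::real^'a. 0)" for "is"
    by (induction "is") (simp_all add: iter_partial_simps)
  then show ?thesis by (simp add: jet_bound_def)
qed

lemma jet_bound_sum:
  assumes "open V" and "finite S" and "\<And>k. k \<in> S \<Longrightarrow> jet_bound V N (g k) (\<beta> k)"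
  shows "jet_bound V N (\<lambda>x. \<Sum>k\<in>S. g k x) (\<lambda>n. \<Sum>k\<in>S. \<beta> k n)"
  using assms(2,3)
  by (induction S rule: finite_induct) (simp_all add: jet_bound_zero jet_bound_add[OF assms(1)])

text \<open>
  Pascal's rule in the form of the induction step of the Leibniz formula.
\<close>

lemma binomial_Leibniz_sum:
  fixes \<beta> \<gamma> :: "nat \<Rightarrow> real"
  shows "(\<Sum>j\<le>n. real (n choose j) * \<beta> (Suc j) * \<gamma> (n - j)) +
      (\<Sum>j\<le>n. real (n choose j) * \<beta> j * \<gamma> (Suc (n - j))) =
    (\<Sum>j\<le>Suc n. real (Suc n choose j) * \<beta> j * \<gamma> (Suc n - j))"
proof -
  have "(\<Sum>j\<le>Suc n. real (Suc n choose j) * \<beta> j * \<gamma> (Suc n - j)) =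
      \<beta> 0 * \<gamma> (Suc n) + (\<Sum>j\<le>n. real (Suc n choose Suc j) * \<beta> (Suc j) * \<gamma> (n - j))"
    by (subst sum.atMost_Suc_shift) simp
  also have "\<dots> = (\<Sum>j\<le>n. real (n choose j) * \<beta> (Suc j) * \<gamma> (n - j)) +
      (\<beta> 0 * \<gamma> (Suc n) + (\<Sum>j\<le>n. real (n choose Suc j) * \<beta> (Suc j) * \<gamma> (n - j)))"
    by (simp add: sum.distrib algebra_simps)
  also have "\<beta> 0 * \<gamma> (Suc n) + (\<Sum>j\<le>n. real (n choose Suc j) * \<beta> (Suc j) * \<gamma> (n - j)) =
      (\<Sum>j\<le>Suc n. real (n choose j) * \<beta> j * \<gamma> (Suc n - j))"
    unfolding sum.atMost_Suc_shift by simp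
  also have "\<dots> = (\<Sum>j\<le>n. real (n choose j) * \<beta> j * \<gamma> (Suc (n - j)))"
    by (simp add: Suc_diff_le)
  finally show ?thesis by simp
qed

text \<open>
  The Leibniz formula. Bounds that depend on the order alone combine with binomial coefficients,
  because a list of \<open>n\<close> directions has \<open>n choose j\<close> sublists of \<open>j\<close> positions.
\<close>

lemma jet_bound_mult:
  assumes "open V" and "jet_bound V N g \<beta>" and "jet_bound V N h \<gamma>"
  shows "jet_bound V N (\<lambda>x. g x * h x) (\<lambda>n. \<Sum>j\<le>n. real (n choose j) * \<beta> j * \<gamma> (n - j))"
  using assms(2,3)
proof (induction N arbitrary: g h \<beta> \<gamma>)
  case 0
  have "\<bar>g x * h x\<bar> \<le> \<beta> 0 * \<gamma> 0" if "x \<in> V" for x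
    using 0 that unfolding jet_bound_0 abs_mult by (meson abs_ge_zero mult_mono order_trans)
  with 0 show ?case
    unfolding jet_bound_0 by (simp add: differentiable_mult)
next
  case (Suc N)
  note gh = Suc.prems[unfolded jet_bound_Suc]
  have pd: "partial_deriv i (\<lambda>x. g x * h x) x = partial_deriv i g x * h x + g x * partial_deriv i h x"
    if "x \<in> V" for i x
  proof -
    obtain D E where D: "(g has_derivative D) (at x)" and E: "(h has_derivative E) (at x)"
      using gh \<open>x \<in> V\<close> unfolding differentiable_def by metis
    show ?thesis
      using partial_deriv_eqI[OF has_derivative_mult[OF D E]]
      by (simp add: partial_deriv_eqI[OF D] partial_deriv_eqI[OF E])
  qed
  have "jet_bound V N g \<beta>" "jet_bound V N h \<gamma>"
    using Suc.prems by (auto elim: jet_bound_mono)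
  then have "jet_bound V N (\<lambda>x. partial_deriv i g x * h x + g x * partial_deriv i h x)
      (\<lambda>n. (\<Sum>j\<le>n. real (n choose j) * \<beta> (Suc j) * \<gamma> (n - j)) +
        (\<Sum>j\<le>n. real (n choose j) * \<beta> j * \<gamma> (Suc (n - j))))" for i
    using gh by (intro jet_bound_add[OF assms(1)] Suc.IH) simp_all
  then have "jet_bound V N (partial_deriv i (\<lambda>x. g x * h x))
      (\<lambda>n. \<Sum>j\<le>Suc n. real (Suc n choose j) * \<beta> j * \<gamma> (Suc n - j))" for i
    unfolding binomial_Leibniz_sum by (rule jet_bound_cong[OF assms(1), rotated]) (rule pd)
  moreover have "\<bar>g x * h x\<bar> \<le> \<beta> 0 * \<gamma> 0" if "x \<in> V" for x
    using gh that unfolding abs_mult by (meson abs_ge_zero mult_mono order_trans)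
  ultimately show ?case
    unfolding jet_bound_Suc using gh by (simp add: differentiable_mult)
qed

lemma sum_count_list_UNIV: "(\<Sum>k\<in>(UNIV :: 'a::finite set). count_list is k) = length is"
proof (induction "is")
  case (Cons i "is")
  have "(\<Sum>k\<in>UNIV. count_list (i # is) k) = (\<Sum>k\<in>UNIV. count_list is k + (if k = i then 1 else 0))"
    by (rule sum.cong) auto
  with Cons show ?case by (simp add: sum.distrib)
qed simp

text \<open>
  A bound for all lists of directions covers in particular the list chosen in \<open>multi_deriv\<close>, whose
  length is \<open>\<bar>\<nu>\<bar>\<close>.
\<close>

lemma C_mildI:
  fixes V :: "(real ^ 'm) set"
  assumes "open V" and "V \<subseteq> unit_cube" and "A > 0" and "B > 0" and "C \<ge> 0"
    and jet: "\<And>N. jet_bound V N g (\<lambda>n. B * A ^ n * fact n powr (C + 1))"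
  shows "C_mild C V g"
proof -
  have jet: "iter_partial is g differentiable (at x)"
    "\<bar>iter_partial is g x\<bar> \<le> B * A ^ length is * fact (length is) powr (C + 1)"
    if "x \<in> V" for "is" x
    using jet[of "length is"] that by (simp_all add: jet_bound_def)
  have "(\<lambda>t. iter_partial is g (x + t *\<^sub>R axis i 1)) differentiable (at 0)" if x: "x \<in> V" for "is" i x
  proof -
    obtain D where "(iter_partial is g has_derivative D) (at x)"
      using jet(1)[OF x] by (auto simp: differentiable_def)
    moreover have "((\<lambda>t::real. x + t *\<^sub>R axis i 1) has_derivative (\<lambda>t. t *\<^sub>R axis i 1)) (at 0)"
      by (auto intro!: derivative_eq_intros)
    ultimately show ?thesis
      unfolding differentiable_def by (fastforce dest: has_derivative_compose)
  qed
  moreover have "continuous_on V (iter_partial is g)" for "is"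
    using jet(1) by (intro continuous_at_imp_continuous_on ballI differentiable_imp_continuous_within)
  ultimately have "smooth_on V g"
    unfolding smooth_on_def by blast
  moreover have "\<bar>multi_deriv \<nu> g x\<bar> \<le>
      B * A ^ (\<Sum>i\<in>UNIV. \<nu> i) * fact (\<Sum>i\<in>UNIV. \<nu> i) powr (C + 1)" if "x \<in> V" for x \<nu>
  proof -
    define ks where "ks = (SOME is. \<forall>i. count_list is i = \<nu> i)"
    have "count_list ks i = \<nu> i" for i
      using someI_ex[OF ex_direction_list[of \<nu>]] unfolding ks_def by blast
    then have "(\<Sum>i\<in>UNIV. \<nu> i) = length ks"
      using sum_count_list_UNIV[of ks] by simp
    then show ?thesis
      using jet(2)[OF that, of ks] by (simp add: multi_deriv_def ks_def)
  qed
  ultimately show ?thesis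
    using assms(1-5) unfolding C_mild_def mild_def by blast
qed

section \<open>Products of functions of one coordinate\<close>

lemma has_derivative_tensor:
  fixes e :: "'m::finite \<Rightarrow> real \<Rightarrow> real"
  assumes "\<And>k. (e k has_real_derivative e' k) (at (x $ k))"
  shows "((\<lambda>x::real^'m. \<Prod>k\<in>UNIV. e k (x $ k)) has_derivative
    (\<lambda>h. \<Sum>k\<in>UNIV. (h $ k * e' k) * (\<Prod>j\<in>UNIV - {k}. e j (x $ j)))) (at x)"
proof (rule has_derivative_prod)
  fix k
  have "((\<lambda>x::real^'m. x $ k) has_derivative (\<lambda>h. h $ k)) (at x)"
    by (intro bounded_linear_imp_has_derivative bounded_linear_vec_nth)
  from has_derivative_compose[OF this assms[of k, unfolded has_field_derivative_def]]
  show "((\<lambda>x. e k (x $ k)) has_derivative (\<lambda>h. h $ k * e' k)) (at x)"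
    by (simp add: mult.commute)
qed

lemma partial_deriv_tensor:
  fixes e :: "'m::finite \<Rightarrow> real \<Rightarrow> real"
  assumes "\<And>k. (e k has_real_derivative e' k) (at (x $ k))"
  shows "partial_deriv i (\<lambda>x. \<Prod>k\<in>UNIV. e k (x $ k)) x = e' i * (\<Prod>j\<in>UNIV - {i}. e j (x $ j))"
proof -
  have "partial_deriv i (\<lambda>x. \<Prod>k\<in>UNIV. e k (x $ k)) x =
      (\<Sum>k\<in>UNIV. axis i 1 $ k * e' k * (\<Prod>j\<in>UNIV - {k}. e j (x $ j)))"
    by (rule partial_deriv_eqI[OF has_derivative_tensor[of e, OF assms]])
  also have "\<dots> = (\<Sum>k\<in>UNIV. if k = i then e' k * (\<Prod>j\<in>UNIV - {k}. e j (x $ j)) else 0)"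
    by (rule sum.cong) (auto simp: axis_def)
  finally show ?thesis by simp
qed

text \<open>
  A partial derivative in direction \<open>i\<close> affects only the \<open>i\<close>-th factor. Each family \<open>E k\<close> consists of
  the successive derivatives of a function of one variable.
\<close>

lemma iter_partial_tensor:
  fixes E :: "'m::finite \<Rightarrow> nat \<Rightarrow> real \<Rightarrow> real"
  assumes "open V" and E: "\<And>k n x. x \<in> V \<Longrightarrow> (E k n has_real_derivative E k (Suc n) (x $ k)) (at (x $ k))"
    and "x \<in> V"
  shows "iter_partial is (\<lambda>x. \<Prod>k\<in>UNIV. E k 0 (x $ k)) x = (\<Prod>k\<in>UNIV. E k (count_list is k) (x $ k))"
  using assms(3)
proof (induction "is" arbitrary: x)
  case (Cons i "is")
  have "iter_partial (i # is) (\<lambda>x. \<Prod>k\<in>UNIV. E k 0 (x $ k)) x =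
      partial_deriv i (\<lambda>x. \<Prod>k\<in>UNIV. E k (count_list is k) (x $ k)) x"
    unfolding iter_partial_simps by (rule partial_deriv_cong[OF assms(1) Cons.prems Cons.IH])
  also have "\<dots> = E i (Suc (count_list is i)) (x $ i) * (\<Prod>j\<in>UNIV - {i}. E j (count_list is j) (x $ j))"
    by (rule partial_deriv_tensor) (rule E[OF Cons.prems])
  also have "\<dots> = (\<Prod>k\<in>UNIV. E k (count_list (i # is) k) (x $ k))"
  proof -
    have "(\<Prod>k\<in>UNIV. E k (count_list (i # is) k) (x $ k)) =
        E i (count_list (i # is) i) (x $ i) * (\<Prod>j\<in>UNIV - {i}. E j (count_list (i # is) j) (x $ j))"
      by (rule prod.remove) auto
    also have "(\<Prod>j\<in>UNIV - {i}. E j (count_list (i # is) j) (x $ j)) =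
        (\<Prod>j\<in>UNIV - {i}. E j (count_list is j) (x $ j))"
      by (rule prod.cong) auto
    finally show ?thesis by simp
  qed
  finally show ?case .
qed (simp add: iter_partial_simps)

section \<open>Gevrey bounds for products and compositions\<close>

lemma fact_mult_le_fact_add: "(fact j * fact k :: real) \<le> fact (j + k)"
proof -
  have "fact j * fact k \<le> (fact (j + k) :: nat)"
    by (rule dvd_imp_le[OF fact_fact_dvd_fact]) simp
  then have "real (fact j * fact k) \<le> real (fact (j + k))"
    by (rule of_nat_mono)
  then show ?thesis by simp
qed

lemma binomial_mult_fact: "j \<le> n \<Longrightarrow> real (n choose j) * (fact j * fact (n - j)) = fact n"
  by (simp add: binomial_fact field_simps)

text \<open>
  In the Leibniz sum \<open>(n choose j) j! (n - j)!\<close> equals \<open>n!\<close>, the powers \<open>(j! (n - j)!) powr C\<close> are at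
  most \<open>n! powr C\<close> since \<open>C \<ge> 0\<close>, and the geometric parts sum to at most \<open>(A\<^sub>1 + A\<^sub>2)\<^sup>n\<close>.
\<close>

lemma jet_bound_mult_gevrey:
  assumes "open V" and "C \<ge> 0" and "A\<^sub>1 \<ge> 0" and "A\<^sub>2 \<ge> 0" and "B\<^sub>1 \<ge> 0" and "B\<^sub>2 \<ge> 0"
    and g: "jet_bound V N g (\<lambda>n. B\<^sub>1 * A\<^sub>1 ^ n * fact n powr (C + 1))"
    and h: "jet_bound V N h (\<lambda>n. B\<^sub>2 * A\<^sub>2 ^ n * fact n powr (C + 1))"
  shows "jet_bound V N (\<lambda>x. g x * h x) (\<lambda>n. B\<^sub>1 * B\<^sub>2 * (A\<^sub>1 + A\<^sub>2) ^ n * fact n powr (C + 1))"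
proof (rule jet_bound_mono[OF jet_bound_mult[OF assms(1) g h] order_refl])
  fix n
  have term_le: "real (n choose j) * (B\<^sub>1 * A\<^sub>1 ^ j * fact j powr (C + 1)) *
      (B\<^sub>2 * A\<^sub>2 ^ (n - j) * fact (n - j) powr (C + 1))
      \<le> B\<^sub>1 * B\<^sub>2 * fact n powr (C + 1) * (real (n choose j) * A\<^sub>1 ^ j * A\<^sub>2 ^ (n - j))"
    if "j \<le> n" for j
  proof -
    have "(fact j * fact (n - j)) powr C \<le> (fact n :: real) powr C"
      using fact_mult_le_fact_add[of j "n - j"] that assms(2) by (intro powr_mono2) auto
    then have "real (n choose j) * (fact j * fact (n - j)) * (fact j * fact (n - j)) powr C
        \<le> fact n * fact n powr C"
      using binomial_mult_fact[OF that] by simp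
    then have *: "real (n choose j) * (fact j powr (C + 1) * fact (n - j) powr (C + 1))
        \<le> (fact n powr (C + 1) :: real)"
      by (simp add: powr_add powr_mult mult_ac)
    \<comment> \<open>The spare binomial coefficient completes the geometric parts to a binomial sum.\<close>
    have "1 \<le> real (n choose j)"
      using that by (simp add: Suc_le_eq)
    then have **: "real (n choose j) * (fact j powr (C + 1) * fact (n - j) powr (C + 1))
        \<le> fact n powr (C + 1) * real (n choose j)"
      using order_trans[OF *, of "fact n powr (C + 1) * real (n choose j)"] by simp
    have "0 \<le> B\<^sub>1 * B\<^sub>2 * A\<^sub>1 ^ j * A\<^sub>2 ^ (n - j)"
      using assms by simp
    from mult_left_mono[OF ** this] show ?thesis
      by (simp add: mult_ac)
  qed
  have "(\<Sum>j\<le>n. real (n choose j) * (B\<^sub>1 * A\<^sub>1 ^ j * fact j powr (C + 1)) *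
      (B\<^sub>2 * A\<^sub>2 ^ (n - j) * fact (n - j) powr (C + 1)))
      \<le> (\<Sum>j\<le>n. B\<^sub>1 * B\<^sub>2 * fact n powr (C + 1) * (real (n choose j) * A\<^sub>1 ^ j * A\<^sub>2 ^ (n - j)))"
    by (rule sum_mono) (use term_le in simp)
  also have "\<dots> = B\<^sub>1 * B\<^sub>2 * (A\<^sub>1 + A\<^sub>2) ^ n * fact n powr (C + 1)"
    by (simp add: binomial_ring sum_distrib_left mult_ac)
  finally show "(\<Sum>j\<le>n. real (n choose j) * (B\<^sub>1 * A\<^sub>1 ^ j * fact j powr (C + 1)) *
      (B\<^sub>2 * A\<^sub>2 ^ (n - j) * fact (n - j) powr (C + 1)))
      \<le> B\<^sub>1 * B\<^sub>2 * (A\<^sub>1 + A\<^sub>2) ^ n * fact n powr (C + 1)" .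
qed

lemma fact_ratio_mono:
  assumes "j \<le> n"
  shows "(fact n * fact (j + p) :: real) \<le> fact j * fact (n + p)"
  using assms
proof (induction n rule: dec_induct)
  case (step n)
  have "(fact (Suc n) * fact (j + p) :: real) = real (Suc n) * (fact n * fact (j + p))"
    by simp
  also have "\<dots> \<le> real (Suc n + p) * (fact j * fact (n + p))"
    by (intro mult_mono step.IH) auto
  also have "\<dots> = fact j * fact (Suc n + p)"
    by (simp add: algebra_simps)
  finally show ?case .
qed simp

lemma sum_Suc_half_power_le: "(\<Sum>i\<le>n. real (Suc i) * (1/2) ^ i) \<le> 4"
proof -
  have "(\<Sum>i\<le>n. real (Suc i) * (1/2) ^ i) = 4 - (real n + 3) * (1/2) ^ n"
    by (induction n) (simp_all add: field_simps)
  then show ?thesis by simp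
qed

text \<open>
  The numerical induction step for \<open>jet_bound_compose_analytic\<close>, with \<open>c\<close> the dimension of the target
  space: the Leibniz bound for \<open>(\<partial>\<^sub>k G \<circ> b) \<cdot> \<partial>\<^sub>i b\<^sub>k\<close>, summed over \<open>k\<close>, where \<open>G\<close> is a derivative of order
  \<open>p\<close>. In the \<open>j\<close>-th summand the
  factorials contribute at most \<open>(n - j + 1) (n + 1 + p)! (n + 1)! powr C\<close>, and the condition \<open>q \<ge> 2 A\<close> leaves the
  factor \<open>2 ^ (j - n)\<close>, so the sum over \<open>j\<close> is at most \<open>4\<close>; the second condition on \<open>q\<close> absorbs what
  remains.
\<close>

lemma gevrey_chain_rule_step:
  fixes A B C K L q :: real and c n p :: nat
  assumes "C \<ge> 0" "A > 0" "B \<ge> 0" "K \<ge> 0" "L \<ge> 0"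
    and q: "q \<ge> 2 * A" "q \<ge> 4 * real c * L * B * A"
  shows "real c * (\<Sum>j\<le>n. real (n choose j) *
        (K * L ^ Suc p * fact (j + Suc p) * fact j powr C * q ^ j) *
        (B * A ^ Suc (n - j) * fact (Suc (n - j)) powr (C + 1)))
      \<le> K * L ^ p * fact (Suc n + p) * fact (Suc n) powr C * q ^ Suc n"
proof -
  define R where "R = K * L ^ p * fact (Suc n + p) * fact (Suc n) powr C * q ^ n"
  have R: "R \<ge> 0" using assms by (simp add: R_def)
  have "q > 0" using assms(2) q(1) by linarith
  have term_le: "real (n choose j) *
        (K * L ^ Suc p * fact (j + Suc p) * fact j powr C * q ^ j) *
        (B * A ^ Suc (n - j) * fact (Suc (n - j)) powr (C + 1))
      \<le> R * (L * B * A) * (real (Suc (n - j)) * (1/2) ^ (n - j))" if "j \<le> n" for j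
  proof -
    have "fact j * (real (n choose j) * fact (n - j) * fact (j + Suc p)) = fact n * fact (j + Suc p)"
      using binomial_mult_fact[OF that] by (simp add: mult_ac)
    also have "\<dots> \<le> fact j * fact (n + Suc p)"
      by (rule fact_ratio_mono[OF that])
    finally have f1: "real (n choose j) * fact (n - j) * fact (j + Suc p) \<le> fact (Suc n + p)"
      by simp
    have "(fact j * fact (Suc (n - j))) powr C \<le> (fact (Suc n) :: real) powr C"
      using fact_mult_le_fact_add[of j "Suc (n - j)"] that assms(1)
      by (intro powr_mono2) (auto simp del: fact_Suc)
    then have f2: "fact j powr C * fact (Suc (n - j)) powr C \<le> (fact (Suc n) :: real) powr C"
      by (subst (asm) powr_mult) (auto simp del: fact_Suc)
    have "q ^ j * A ^ (n - j) \<le> q ^ j * (q / 2) ^ (n - j)"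
      using q(1) assms(2) \<open>q > 0\<close> by (intro mult_left_mono power_mono) auto
    also have "\<dots> = q ^ n * (1/2) ^ (n - j)"
      using that by (simp add: power_divide power_add[symmetric])
    finally have f3: "q ^ j * A ^ (n - j) \<le> q ^ n * (1/2) ^ (n - j)" .
    have fS: "fact (Suc (n - j)) powr (C + 1)
        = real (Suc (n - j)) * fact (n - j) * fact (Suc (n - j)) powr C"
      by (simp add: powr_add)
    have "real (n choose j) *
        (K * L ^ Suc p * fact (j + Suc p) * fact j powr C * q ^ j) *
        (B * A ^ Suc (n - j) * fact (Suc (n - j)) powr (C + 1))
      = (K * L ^ p * (L * B * A) * real (Suc (n - j))) *
        ((real (n choose j) * fact (n - j) * fact (j + Suc p)) *
        ((fact j powr C * fact (Suc (n - j)) powr C) * (q ^ j * A ^ (n - j))))"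
      unfolding fS by (simp add: mult_ac del: fact_Suc)
    also have "\<dots> \<le> (K * L ^ p * (L * B * A) * real (Suc (n - j))) *
        (fact (Suc n + p) * (fact (Suc n) powr C * (q ^ n * (1/2) ^ (n - j))))"
      using assms \<open>q > 0\<close>
      by (intro mult_left_mono mult_mono f1 f2 f3) (auto simp del: fact_Suc)
    also have "\<dots> = R * (L * B * A) * (real (Suc (n - j)) * (1/2) ^ (n - j))"
      by (simp add: R_def mult_ac del: fact_Suc)
    finally show ?thesis .
  qed
  have "(\<Sum>j\<le>n. real (n choose j) *
        (K * L ^ Suc p * fact (j + Suc p) * fact j powr C * q ^ j) *
        (B * A ^ Suc (n - j) * fact (Suc (n - j)) powr (C + 1)))
      \<le> (\<Sum>j\<le>n. R * (L * B * A) * (real (Suc (n - j)) * (1/2) ^ (n - j)))"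
    by (rule sum_mono) (use term_le in simp)
  also have "\<dots> = R * (L * B * A) * (\<Sum>i\<le>n. real (Suc i) * (1/2) ^ i)"
    unfolding sum_distrib_left[symmetric]
    by (subst sum.atLeastAtMost_rev[of _ 0 n, simplified atLeast0AtMost]) simp
  also have "\<dots> \<le> R * (L * B * A) * 4"
    using R assms by (intro mult_left_mono sum_Suc_half_power_le) auto
  finally have "real c * (\<Sum>j\<le>n. real (n choose j) *
        (K * L ^ Suc p * fact (j + Suc p) * fact j powr C * q ^ j) *
        (B * A ^ Suc (n - j) * fact (Suc (n - j)) powr (C + 1)))
      \<le> real c * (R * (L * B * A) * 4)"
    by (rule mult_left_mono) simp
  also have "\<dots> = R * (4 * real c * L * B * A)" by simp
  also have "\<dots> \<le> R * q" by (rule mult_left_mono[OF q(2) R])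
  also have "\<dots> = K * L ^ p * fact (Suc n + p) * fact (Suc n) powr C * q ^ Suc n"
    by (simp add: R_def mult_ac del: fact_Suc)
  finally show ?thesis .
qed

text \<open>
  Induction on the order, simultaneously for all derivatives of the outer function: by the chain rule
  \<open>\<partial>\<^sub>i (G \<circ> b) = \<Sum>\<^sub>k (\<partial>\<^sub>k G \<circ> b) \<cdot> \<partial>\<^sub>i b\<^sub>k\<close>, and \<open>\<partial>\<^sub>k G\<close> is again a derivative of \<open>F\<close>, one order higher.
  The weight \<open>(n + length ks)!\<close> is what makes this trade of an inner for an outer derivative
  consistent.
\<close>

lemma jet_bound_compose_analytic:
  fixes V :: "(real ^ 'm) set" and b :: "real ^ 'm \<Rightarrow> real ^ 'n" and F :: "real ^ 'n \<Rightarrow> real"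
    and A B C K L :: real
  assumes "open V" and "C \<ge> 0" "A > 0" "B \<ge> 0" "K \<ge> 0" "L \<ge> 0"
    and F: "\<And>ks y. y \<in> S \<Longrightarrow>
      (iter_partial ks F has_derivative (\<lambda>h. \<Sum>k\<in>UNIV. h $ k * iter_partial (k # ks) F y)) (at y)"
    and F_bound: "\<And>ks y. y \<in> S \<Longrightarrow>
      \<bar>iter_partial ks F y\<bar> \<le> K * L ^ length ks * fact (length ks)"
    and b: "\<And>k. jet_bound V N (\<lambda>x. b x $ k) (\<lambda>n. B * A ^ n * fact n powr (C + 1))"
    and b_S: "\<And>x. x \<in> V \<Longrightarrow> b x \<in> S"
    and q: "q = A * (2 + 4 * real CARD('n) * L * B)"
  shows "jet_bound V N (\<lambda>x. iter_partial ks F (b x))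
    (\<lambda>n. K * L ^ length ks * fact (n + length ks) * fact n powr C * q ^ n)"
  using b
proof (induction N arbitrary: ks)
  have pd: "(\<lambda>x. iter_partial ks F (b x)) differentiable (at x)"
    "partial_deriv i (\<lambda>x. iter_partial ks F (b x)) x =
      (\<Sum>k\<in>UNIV. iter_partial (k # ks) F (b x) * partial_deriv i (\<lambda>x. b x $ k) x)"
    if x: "x \<in> V" and diff: "\<And>k. (\<lambda>x. b x $ k) differentiable (at x)" for x ks i
  proof -
    have "\<forall>k. \<exists>D. ((\<lambda>x. b x $ k) has_derivative D) (at x)"
      using diff by (simp add: differentiable_def)
    then obtain D where D: "\<And>k. ((\<lambda>x. b x $ k) has_derivative D k) (at x)"
      by metis
    have "(b has_derivative (\<lambda>h. \<chi> k. D k h)) (at x)"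
      unfolding has_derivative_componentwise_within[of b]
      using D by (auto simp: Basis_vec_def inner_axis)
    from diff_chain_at[OF this F[OF b_S[OF x]], of ks]
    have *: "((\<lambda>x. iter_partial ks F (b x)) has_derivative
        (\<lambda>h. \<Sum>k\<in>UNIV. D k h * iter_partial (k # ks) F (b x))) (at x)"
      by (simp add: o_def)
    then show "(\<lambda>x. iter_partial ks F (b x)) differentiable (at x)"
      by (rule differentiableI)
    show "partial_deriv i (\<lambda>x. iter_partial ks F (b x)) x =
      (\<Sum>k\<in>UNIV. iter_partial (k # ks) F (b x) * partial_deriv i (\<lambda>x. b x $ k) x)"
      by (simp add: partial_deriv_eqI[OF *] partial_deriv_eqI[OF D] mult.commute)
  qed
  {
    case 0
    then show ?case
      using pd(1) F_bound b_S by (simp add: jet_bound_0)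
  next
    case (Suc N)
    note b = Suc.prems
    have b_diff: "(\<lambda>x. b x $ k) differentiable (at x)" if "x \<in> V" for k x
      using b that by (auto simp: jet_bound_Suc)
    have b_N: "jet_bound V N (\<lambda>x. b x $ k) (\<lambda>n. B * A ^ n * fact n powr (C + 1))" for k
      using b by (rule jet_bound_mono) auto
    have b': "jet_bound V N (partial_deriv i (\<lambda>x. b x $ k))
        (\<lambda>n. B * A ^ Suc n * fact (Suc n) powr (C + 1))" for i k
      using b by (simp add: jet_bound_Suc)
    have q_ge: "q \<ge> 2 * A" "q \<ge> 4 * real CARD('n) * L * B * A"
      using assms(3-6) by (auto simp: q algebra_simps)
    have "jet_bound V N (\<lambda>x. \<Sum>k\<in>UNIV. iter_partial (k # ks) F (b x) * partial_deriv i (\<lambda>x. b x $ k) x)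
        (\<lambda>n. \<Sum>k\<in>(UNIV :: 'n set). \<Sum>j\<le>n. real (n choose j) *
          (K * L ^ length (k # ks) * fact (j + length (k # ks)) * fact j powr C * q ^ j) *
          (B * A ^ Suc (n - j) * fact (Suc (n - j)) powr (C + 1)))" for i
      by (intro jet_bound_sum jet_bound_mult assms(1) finite Suc.IH b_N b')
    then have "jet_bound V N (\<lambda>x. \<Sum>k\<in>UNIV. iter_partial (k # ks) F (b x) * partial_deriv i (\<lambda>x. b x $ k) x)
        (\<lambda>n. K * L ^ length ks * fact (Suc n + length ks) * fact (Suc n) powr C * q ^ Suc n)" for i
      by (rule jet_bound_mono)
        (use gevrey_chain_rule_step[OF assms(2-6) q_ge] in \<open>simp_all del: fact_Suc power_Suc add_Suc add_Suc_right list.size(4) add: length_Cons\<close>)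
    then have "jet_bound V N (partial_deriv i (\<lambda>x. iter_partial ks F (b x)))
        (\<lambda>n. K * L ^ length ks * fact (Suc n + length ks) * fact (Suc n) powr C * q ^ Suc n)" for i
      by (rule jet_bound_cong[OF assms(1), rotated]) (rule pd(2), simp_all add: b_diff)
    then show ?case
      unfolding jet_bound_Suc using pd(1) b_diff F_bound b_S by simp
  }
qed

section \<open>Derivatives of real-analytic functions\<close>

text \<open>
  The multi-index geometric series factors into one-dimensional ones. Since \<open>infsum\<close> is \<open>0\<close> for a
  family without a sum, the product formula with its nonzero right-hand side already gives
  summability.
\<close>

lemma summable_on_geometric_multi:
  "(\<lambda>\<nu> :: 'n::finite \<Rightarrow> nat. (1/2::real) ^ (\<Sum>i\<in>UNIV. \<nu> i)) summable_on UNIV"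
proof -
  let ?f = "\<lambda>(_ :: 'n) (n :: nat). (1/2 :: real) ^ n"
  have geometric: "(\<lambda>n :: nat. (1/2 :: real) ^ n) summable_on UNIV"
    by (rule norm_summable_imp_summable_on) (simp add: power_abs)
  have "(\<Sum>\<^sub>\<infinity>g\<in>PiE UNIV (\<lambda>_. UNIV). \<Prod>i\<in>UNIV. ?f i (g i)) = (\<Prod>i\<in>(UNIV :: 'n set). infsum (?f i) UNIV)"
    using geometric by (intro infsum_prod_PiE_abs) (auto simp: power_abs)
  moreover have "infsum (\<lambda>n :: nat. (1/2 :: real) ^ n) UNIV > 0"
    using finite_sum_le_infsum[OF geometric, of "{0}"] by simp
  ultimately have "(\<Sum>\<^sub>\<infinity>\<nu> :: 'n \<Rightarrow> nat. (1/2 :: real) ^ (\<Sum>i\<in>UNIV. \<nu> i)) \<noteq> 0"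
    by (simp add: PiE_UNIV_domain power_sum)
  then show ?thesis
    using infsum_not_exists by blast
qed

definition multi_power :: "real ^ 'n \<Rightarrow> ('n \<Rightarrow> nat) \<Rightarrow> real" where
  "multi_power z \<nu> = (\<Prod>i\<in>UNIV. (z $ i) ^ \<nu> i)"

definition power_series :: "(('n \<Rightarrow> nat) \<Rightarrow> real) \<Rightarrow> real ^ 'n \<Rightarrow> real ^ 'n \<Rightarrow> real" where
  "power_series c a y = (\<Sum>\<^sub>\<infinity>\<nu>. c \<nu> * multi_power (y - a) \<nu>)"

text \<open>
  The coefficients of the \<open>k\<close>-th partial derivative of a power series with coefficients \<open>c\<close>.
\<close>

definition shift_coeff :: "'n \<Rightarrow> (('n \<Rightarrow> nat) \<Rightarrow> real) \<Rightarrow> ('n \<Rightarrow> nat) \<Rightarrow> real" where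
  "shift_coeff k c \<nu> = real (Suc (\<nu> k)) * c (\<nu>(k := Suc (\<nu> k)))"

lemma abs_multi_power_le:
  fixes z :: "real ^ 'n"
  assumes "norm z \<le> s"
  shows "\<bar>multi_power z \<nu>\<bar> \<le> s ^ (\<Sum>i\<in>UNIV. \<nu> i)"
proof -
  have "\<bar>multi_power z \<nu>\<bar> = (\<Prod>i\<in>UNIV. \<bar>z $ i\<bar> ^ \<nu> i)"
    by (simp add: multi_power_def abs_prod power_abs)
  also have "\<dots> \<le> (\<Prod>i\<in>UNIV. s ^ \<nu> i)"
  proof (rule prod_mono, intro conjI power_mono)
    show "\<bar>z $ i\<bar> \<le> s" for i
      using component_le_norm_cart[of z i] assms by linarith
  qed auto
  finally show ?thesis by (simp add: power_sum)
qed

lemma power_series_summable: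
  fixes c :: "('n::finite \<Rightarrow> nat) \<Rightarrow> real"
  assumes "\<sigma> > 0" and c: "\<And>\<nu>. \<bar>c \<nu>\<bar> \<le> M / \<sigma> ^ (\<Sum>i\<in>UNIV. \<nu> i)" and y: "norm (y - a) \<le> \<sigma> / 2"
  shows "\<bar>c \<nu> * multi_power (y - a) \<nu>\<bar> \<le> M * (1/2) ^ (\<Sum>i\<in>UNIV. \<nu> i)"
    and "(\<lambda>\<nu>. c \<nu> * multi_power (y - a) \<nu>) summable_on UNIV"
    and "\<bar>power_series c a y\<bar> \<le> M * (\<Sum>\<^sub>\<infinity>\<nu> :: 'n \<Rightarrow> nat. (1/2) ^ (\<Sum>i\<in>UNIV. \<nu> i))"
proof -
  show term_le: "\<bar>c \<nu> * multi_power (y - a) \<nu>\<bar> \<le> M * (1/2) ^ (\<Sum>i\<in>UNIV. \<nu> i)" for \<nu>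
  proof -
    have "\<bar>c \<nu> * multi_power (y - a) \<nu>\<bar> \<le>
        (M / \<sigma> ^ (\<Sum>i\<in>UNIV. \<nu> i)) * (\<sigma> / 2) ^ (\<Sum>i\<in>UNIV. \<nu> i)"
      unfolding abs_mult
      by (intro mult_mono c abs_multi_power_le y) (use order_trans[OF abs_ge_zero c] in auto)
    then show ?thesis using assms(1) by (simp add: power_divide)
  qed
  have majorant: "(\<lambda>\<nu> :: 'n \<Rightarrow> nat. M * (1/2) ^ (\<Sum>i\<in>UNIV. \<nu> i)) summable_on UNIV"
    by (intro summable_on_cmult_right summable_on_geometric_multi)
  then have abs_summable: "(\<lambda>\<nu>. norm (c \<nu> * multi_power (y - a) \<nu>)) summable_on UNIV"
    by (rule summable_on_comparison_test) (use term_le in auto)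
  then show "(\<lambda>\<nu>. c \<nu> * multi_power (y - a) \<nu>) summable_on UNIV"
    by (rule abs_summable_summable)
  have "\<bar>power_series c a y\<bar> \<le> (\<Sum>\<^sub>\<infinity>\<nu>. norm (c \<nu> * multi_power (y - a) \<nu>))"
    unfolding power_series_def real_norm_def[symmetric] by (rule norm_infsum_bound[OF abs_summable])
  also have "\<dots> \<le> (\<Sum>\<^sub>\<infinity>\<nu> :: 'n \<Rightarrow> nat. M * (1/2) ^ (\<Sum>i\<in>UNIV. \<nu> i))"
    by (rule infsum_mono[OF abs_summable majorant]) (use term_le in auto)
  also have "\<dots> = M * (\<Sum>\<^sub>\<infinity>\<nu> :: 'n \<Rightarrow> nat. (1/2) ^ (\<Sum>i\<in>UNIV. \<nu> i))"
    by (rule infsum_cmult_right) (simp add: summable_on_geometric_multi)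
  finally show "\<bar>power_series c a y\<bar> \<le> M * (\<Sum>\<^sub>\<infinity>\<nu> :: 'n \<Rightarrow> nat. (1/2) ^ (\<Sum>i\<in>UNIV. \<nu> i))" .
qed

lemma sum_fun_upd_Suc: "(\<Sum>i\<in>UNIV. (\<nu>(k := Suc (\<nu> k))) i) = Suc (\<Sum>i\<in>(UNIV :: 'n::finite set). \<nu> i)"
proof -
  have "(\<Sum>i\<in>UNIV. (\<nu>(k := Suc (\<nu> k))) i) = (\<Sum>i\<in>UNIV. \<nu> i + (if i = k then 1 else 0))"
    by (rule sum.cong) auto
  then show ?thesis by (simp add: sum.distrib)
qed

text \<open>
  Each differentiation multiplies by at most the new total degree, which yields the factor
  \<open>(s + p)! / s!\<close> in total degree \<open>s\<close> after \<open>p\<close> of them. It is at most \<open>2 ^ (s + p) p!\<close>, so halving the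
  radius once pays for derivatives of every order.
\<close>

lemma foldr_shift_coeff_bound:
  fixes c :: "('n::finite \<Rightarrow> nat) \<Rightarrow> real"
  assumes "\<rho> > 0" and c: "\<And>\<nu>. \<bar>c \<nu>\<bar> \<le> M / \<rho> ^ (\<Sum>i\<in>UNIV. \<nu> i)"
  shows "\<bar>foldr shift_coeff ks c \<nu>\<bar> \<le>
    M * (2 / \<rho>) ^ length ks * fact (length ks) / (\<rho> / 2) ^ (\<Sum>i\<in>UNIV. \<nu> i)"
proof -
  have M: "M \<ge> 0" using order_trans[OF abs_ge_zero c[of "\<lambda>_. 0"]] by simp
  have "\<bar>foldr shift_coeff ks c \<nu>\<bar> \<le>
    M * (fact ((\<Sum>i\<in>UNIV. \<nu> i) + length ks) / fact (\<Sum>i\<in>UNIV. \<nu> i)) / \<rho> ^ ((\<Sum>i\<in>UNIV. \<nu> i) + length ks)"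
  proof (induction ks arbitrary: \<nu>)
    case Nil
    then show ?case using c by simp
  next
    case (Cons k ks)
    define s where "s = (\<Sum>i\<in>UNIV. \<nu> i)"
    have "\<nu> k \<le> s" unfolding s_def by (rule member_le_sum) auto
    have "\<bar>foldr shift_coeff (k # ks) c \<nu>\<bar> =
        real (Suc (\<nu> k)) * \<bar>foldr shift_coeff ks c (\<nu>(k := Suc (\<nu> k)))\<bar>"
      by (simp add: shift_coeff_def abs_mult)
    also have "\<dots> \<le> real (Suc s) *
        (M * (fact (Suc s + length ks) / fact (Suc s)) / \<rho> ^ (Suc s + length ks))"
      using Cons[of "\<nu>(k := Suc (\<nu> k))"] \<open>\<nu> k \<le> s\<close> unfolding sum_fun_upd_Suc s_def[symmetric]
      by (intro mult_mono) (auto simp del: fun_upd_apply)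
    also have "\<dots> = M * (fact (s + length (k # ks)) / fact s) / \<rho> ^ (s + length (k # ks))"
      by (simp add: field_simps del: of_nat_Suc) 
    finally show ?case by (simp only: s_def)
  qed
  also have "\<dots> \<le> M * (2 ^ ((\<Sum>i\<in>UNIV. \<nu> i) + length ks) * fact (length ks)) / \<rho> ^ ((\<Sum>i\<in>UNIV. \<nu> i) + length ks)"
  proof (intro divide_right_mono mult_left_mono M)
    define s where "s = (\<Sum>i\<in>UNIV. \<nu> i)"
    have "fact (s + length ks) / fact s = real ((s + length ks) choose s) * fact (length ks)"
      by (simp add: binomial_fact)
    also have "\<dots> \<le> 2 ^ (s + length ks) * fact (length ks)"
    proof (rule mult_right_mono)
      have "real ((s + length ks) choose s) \<le> real (2 ^ (s + length ks))"
        by (rule of_nat_mono) (rule binomial_le_pow2)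
      then show "real ((s + length ks) choose s) \<le> 2 ^ (s + length ks)" by simp
    qed simp
    finally show "fact ((\<Sum>i\<in>UNIV. \<nu> i) + length ks) / fact (\<Sum>i\<in>UNIV. \<nu> i)
        \<le> (2 ^ ((\<Sum>i\<in>UNIV. \<nu> i) + length ks) * fact (length ks) :: real)"
      by (simp add: s_def)
  qed (use assms in auto)
  also have "\<dots> = M * (2 / \<rho>) ^ length ks * fact (length ks) / (\<rho> / 2) ^ (\<Sum>i\<in>UNIV. \<nu> i)"
    by (simp add: power_add power_divide mult_ac)
  finally show ?thesis .
qed

text \<open>
  Term-by-term differentiation: the differentiated series is dominated by a geometric one on the
  ball, hence uniformly convergent. The criterion for series over \<open>nat\<close> is applied after enumerating
  the multi-indices.
\<close>

lemma has_derivative_power_series: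
  fixes c :: "('n::finite \<Rightarrow> nat) \<Rightarrow> real"
  assumes "\<sigma> > 0" and c: "\<And>\<nu>. \<bar>c \<nu>\<bar> \<le> M / \<sigma> ^ (\<Sum>i\<in>UNIV. \<nu> i)" and y: "y \<in> ball a (\<sigma> / 4)"
  shows "(power_series c a has_derivative
    (\<lambda>h. \<Sum>k\<in>UNIV. h $ k * power_series (shift_coeff k c) a y)) (at y)"
proof -
  define S where "S = ball a (\<sigma> / 4)"
  \<comment> \<open>The term of index \<open>\<nu>\<close>, differentiated in direction \<open>k\<close>, is the term of index
    \<open>dec k \<nu>\<close> of the derived series; it vanishes if \<open>\<nu> k = 0\<close>.\<close>
  define dec where "dec k \<nu> = \<nu>(k := \<nu> k - 1)" for k :: 'n and \<nu> :: "'n \<Rightarrow> nat"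
  define t where "t k \<nu> y = (if \<nu> k = 0 then 0 else
    shift_coeff k c (dec k \<nu>) * multi_power (y - a) (dec k \<nu>))" for k \<nu> y
  have term_deriv: "((\<lambda>y. c \<nu> * multi_power (y - a) \<nu>) has_derivative
      (\<lambda>h. \<Sum>k\<in>UNIV. h $ k * t k \<nu> y)) (at y)" for \<nu> y
  proof -
    have "((\<lambda>y. \<Prod>k\<in>UNIV. (y $ k - a $ k) ^ \<nu> k) has_derivative
        (\<lambda>h. \<Sum>k\<in>UNIV. (h $ k * (real (\<nu> k) * (y $ k - a $ k) ^ (\<nu> k - 1))) *
          (\<Prod>j\<in>UNIV - {k}. (y $ j - a $ j) ^ \<nu> j))) (at y)"
      by (rule has_derivative_tensor[of "\<lambda>k x. (x - a $ k) ^ \<nu> k"]) (auto intro!: derivative_eq_intros)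
    then have "((\<lambda>y. c \<nu> * multi_power (y - a) \<nu>) has_derivative
        (\<lambda>h. c \<nu> * (\<Sum>k\<in>UNIV. (h $ k * (real (\<nu> k) * (y $ k - a $ k) ^ (\<nu> k - 1))) *
          (\<Prod>j\<in>UNIV - {k}. (y $ j - a $ j) ^ \<nu> j)))) (at y)"
      unfolding multi_power_def by (simp add: has_derivative_mult_right)
    moreover have "t k \<nu> y = c \<nu> * (real (\<nu> k) * (y $ k - a $ k) ^ (\<nu> k - 1)) *
          (\<Prod>j\<in>UNIV - {k}. (y $ j - a $ j) ^ \<nu> j)" for k
    proof (cases "\<nu> k")
      case (Suc n)
      have "multi_power (y - a) (dec k \<nu>) = ((y - a) $ k) ^ (dec k \<nu> k) *
          (\<Prod>j\<in>UNIV - {k}. ((y - a) $ j) ^ (dec k \<nu> j))"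
        unfolding multi_power_def by (rule prod.remove) auto
      also have "(\<Prod>j\<in>UNIV - {k}. ((y - a) $ j) ^ (dec k \<nu> j)) = (\<Prod>j\<in>UNIV - {k}. (y $ j - a $ j) ^ \<nu> j)"
        by (rule prod.cong) (auto simp: dec_def)
      finally have "multi_power (y - a) (dec k \<nu>) =
          (y $ k - a $ k) ^ n * (\<Prod>j\<in>UNIV - {k}. (y $ j - a $ j) ^ \<nu> j)"
        using Suc by (simp add: dec_def del: fun_upd_apply add: fun_upd_same)
      moreover have "shift_coeff k c (dec k \<nu>) = real (\<nu> k) * c \<nu>"
        using Suc by (simp add: shift_coeff_def dec_def fun_upd_idem)
      ultimately show ?thesis
        using Suc by (simp add: t_def)
    qed (simp add: t_def)
    ultimately show ?thesis
      by (simp add: sum_distrib_left mult_ac)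
  qed
  have shift_bound: "\<bar>shift_coeff k c \<nu>\<bar> \<le> (M * (2 / \<sigma>)) / (\<sigma> / 2) ^ (\<Sum>i\<in>UNIV. \<nu> i)" for k \<nu>
    using foldr_shift_coeff_bound[OF assms(1) c, of "[k]"] by simp
  have M: "M \<ge> 0" using order_trans[OF abs_ge_zero c[of "\<lambda>_. 0"]] by simp
  have half: "\<sigma> / 2 > 0" using assms(1) by simp
  have S_norm: "norm (y - a) \<le> (\<sigma> / 2) / 2" if "y \<in> S" for y
    using that by (simp add: S_def dist_norm norm_minus_commute)
  have t_bound: "\<bar>t k \<nu> y\<bar> \<le> 4 * M / \<sigma> * (1/2) ^ (\<Sum>i\<in>UNIV. \<nu> i)" if "y \<in> S" for k \<nu> y
  proof (cases "\<nu> k")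
    case 0
    then show ?thesis using M assms(1) by (simp add: t_def)
  next
    case (Suc n)
    have "(dec k \<nu>)(k := Suc (dec k \<nu> k)) = \<nu>"
      using Suc by (auto simp: dec_def)
    then have "(\<Sum>i\<in>UNIV. \<nu> i) = Suc (\<Sum>i\<in>UNIV. dec k \<nu> i)"
      using sum_fun_upd_Suc[of "dec k \<nu>" k] by simp
    then show ?thesis
      using power_series_summable(1)[OF half shift_bound[of k] S_norm[OF that], of "dec k \<nu>"] Suc
      by (simp add: t_def mult_ac)
  qed
  have t_sum: "((\<lambda>\<nu>. t k \<nu> y) has_sum power_series (shift_coeff k c) a y) UNIV" if "y \<in> S" for k y
  proof -
    let ?inc = "\<lambda>\<nu> :: 'n \<Rightarrow> nat. \<nu>(k := Suc (\<nu> k))"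
    have "((\<lambda>\<nu>. shift_coeff k c \<nu> * multi_power (y - a) \<nu>) has_sum power_series (shift_coeff k c) a y) UNIV"
      unfolding power_series_def
      by (rule has_sum_infsum[OF power_series_summable(2)[OF half shift_bound[of k] S_norm[OF that]]])
    also have "(\<lambda>\<nu>. shift_coeff k c \<nu> * multi_power (y - a) \<nu>) = (\<lambda>\<nu>. t k \<nu> y) \<circ> ?inc"
      by (simp add: fun_eq_iff t_def dec_def)
    also have "((\<lambda>\<nu>. t k \<nu> y) \<circ> ?inc has_sum power_series (shift_coeff k c) a y) UNIV \<longleftrightarrow>
        ((\<lambda>\<nu>. t k \<nu> y) has_sum power_series (shift_coeff k c) a y) (range ?inc)"
    proof (rule has_sum_reindex[symmetric], rule inj_onI)
      fix \<mu> \<nu> assume eq: "?inc \<mu> = ?inc \<nu>"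
      show "\<mu> = \<nu>"
      proof
        show "\<mu> i = \<nu> i" for i
          using fun_cong[OF eq, of i] by (cases "i = k") auto
      qed
    qed
    also have "\<dots> \<longleftrightarrow> ((\<lambda>\<nu>. t k \<nu> y) has_sum power_series (shift_coeff k c) a y) UNIV"
    proof (rule has_sum_cong_neutral)
      fix \<nu> assume "\<nu> \<in> UNIV - range ?inc"
      moreover have "\<nu> = ?inc (dec k \<nu>)" if "\<nu> k \<noteq> 0"
        using that by (auto simp: dec_def)
      ultimately show "t k \<nu> y = 0"
        by (auto simp: t_def)
    qed auto
    finally show ?thesis .
  qed
  define enum where "enum = from_nat_into (UNIV :: ('n \<Rightarrow> nat) set)"
  have enum: "bij_betw enum UNIV UNIV"
    unfolding enum_def
  proof (rule bij_betw_from_nat_into)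
    show "countable (UNIV :: ('n \<Rightarrow> nat) set)" by simp
    have "range (\<lambda>\<nu> :: 'n \<Rightarrow> nat. \<nu> undefined) = UNIV"
      by (auto intro!: image_eqI[where x = "\<lambda>_. n" for n])
    then show "infinite (UNIV :: ('n \<Rightarrow> nat) set)"
      using finite_imageI infinite_UNIV_nat by metis
  qed
  have sums_enum: "(\<lambda>i. f (enum i)) sums l" if "(f has_sum l) UNIV" for f :: "('n \<Rightarrow> nat) \<Rightarrow> real" and l
    using that has_sum_reindex_bij_betw[OF enum, of f l] by (auto dest: has_sum_imp_sums)
  have unif: "uniform_limit S (\<lambda>N y. \<Sum>i<N. t k (enum i) y) (power_series (shift_coeff k c) a) sequentially" for k
  proof -
    have "summable (\<lambda>i. 4 * M / \<sigma> * (1/2) ^ (\<Sum>j\<in>UNIV. enum i j))"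
      using sums_enum[OF has_sum_infsum[OF summable_on_geometric_multi]]
      by (intro summable_mult) (simp add: sums_iff)
    then have "uniform_limit S (\<lambda>N y. \<Sum>i<N. t k (enum i) y) (\<lambda>y. \<Sum>i. t k (enum i) y) sequentially"
      by (rule Weierstrass_m_test[rotated]) (unfold real_norm_def, rule t_bound)
    moreover have "(\<Sum>i. t k (enum i) y) = power_series (shift_coeff k c) a y" if "y \<in> S" for y
      using sums_enum[OF t_sum[OF that]] by (rule sums_unique[symmetric])
    ultimately show ?thesis
      by (subst (asm) uniform_limit_cong'[where g = "\<lambda>N y. \<Sum>i<N. t k (enum i) y" and i = "power_series (shift_coeff k c) a"]) auto
  qed
  have "\<exists>g. \<forall>y\<in>S. (\<lambda>i. c (enum i) * multi_power (y - a) (enum i)) sums g y \<and>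
      (g has_derivative (\<lambda>h. \<Sum>k\<in>UNIV. h $ k * power_series (shift_coeff k c) a y)) (at y within S)"
  proof (rule has_derivative_series)
    show "convex S" by (simp add: S_def)
    show "((\<lambda>y. c (enum i) * multi_power (y - a) (enum i)) has_derivative
        (\<lambda>h. \<Sum>k\<in>UNIV. h $ k * t k (enum i) y)) (at y within S)" for i y
      using term_deriv by (rule has_derivative_at_withinI)
    show "a \<in> S" using assms(1) by (simp add: S_def)
    then have "norm (a - a) \<le> \<sigma> / 2" using assms(1) by simp
    then show "(\<lambda>i. c (enum i) * multi_power (a - a) (enum i)) sums power_series c a a"
      unfolding power_series_def
      by (intro sums_enum has_sum_infsum power_series_summable(2)[OF assms(1) c])
    fix e :: real assume e: "e > 0"
    have "\<forall>\<^sub>F N in sequentially. \<forall>k. \<forall>y\<in>S.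
        \<bar>(\<Sum>i<N. t k (enum i) y) - power_series (shift_coeff k c) a y\<bar> < e / real CARD('n)"
      using unif e by (intro eventually_all_finite) (simp add: uniform_limit_iff dist_real_def)
    then show "\<forall>\<^sub>F N in sequentially. \<forall>y\<in>S. \<forall>h.
        norm ((\<Sum>i<N. \<Sum>k\<in>UNIV. h $ k * t k (enum i) y) -
          (\<Sum>k\<in>UNIV. h $ k * power_series (shift_coeff k c) a y)) \<le> e * norm h"
    proof (eventually_elim, intro ballI allI)
      fix N y and h :: "real ^ 'n"
      assume N: "\<forall>k. \<forall>y\<in>S. \<bar>(\<Sum>i<N. t k (enum i) y) - power_series (shift_coeff k c) a y\<bar> < e / real CARD('n)"
        and y: "y \<in> S"
      have "(\<Sum>i<N. \<Sum>k\<in>UNIV. h $ k * t k (enum i) y) -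
          (\<Sum>k\<in>UNIV. h $ k * power_series (shift_coeff k c) a y) =
          (\<Sum>k\<in>UNIV. h $ k * ((\<Sum>i<N. t k (enum i) y) - power_series (shift_coeff k c) a y))"
        by (subst sum.swap) (simp add: sum_distrib_left right_diff_distrib sum_subtractf)
      also have "norm \<dots> \<le> (\<Sum>k\<in>(UNIV :: 'n set). norm h * (e / real CARD('n)))"
      proof -
        have "\<bar>(\<Sum>i<N. t k (enum i) y) - power_series (shift_coeff k c) a y\<bar> \<le> e / real CARD('n)" for k
          using N y by (simp add: less_imp_le)
        then show ?thesis
          unfolding real_norm_def
          by (intro order_trans[OF sum_abs] sum_mono, subst abs_mult)
            (intro mult_mono component_le_norm_cart, auto)
      qed
      also have "\<dots> = e * norm h" by simp
      finally show "norm ((\<Sum>i<N. \<Sum>k\<in>UNIV. h $ k * t k (enum i) y) -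
          (\<Sum>k\<in>UNIV. h $ k * power_series (shift_coeff k c) a y)) \<le> e * norm h" .
    qed
  qed
  then obtain g where g: "\<And>y. y \<in> S \<Longrightarrow> (\<lambda>i. c (enum i) * multi_power (y - a) (enum i)) sums g y"
    and g': "\<And>y. y \<in> S \<Longrightarrow>
      (g has_derivative (\<lambda>h. \<Sum>k\<in>UNIV. h $ k * power_series (shift_coeff k c) a y)) (at y within S)"
    by blast
  have g_eq: "g y = power_series c a y" if "y \<in> S" for y
  proof -
    have "norm (y - a) \<le> \<sigma> / 2" using S_norm[OF that] assms(1) by simp
    then have "(\<lambda>i. c (enum i) * multi_power (y - a) (enum i)) sums power_series c a y"
      unfolding power_series_def
      by (intro sums_enum has_sum_infsum power_series_summable(2)[OF assms(1) c])
    with g[OF that] show ?thesis by (rule sums_unique2)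
  qed
  have S: "open S" "y \<in> S" using y by (auto simp: S_def)
  have "(g has_derivative (\<lambda>h. \<Sum>k\<in>UNIV. h $ k * power_series (shift_coeff k c) a y)) (at y)"
    using g'[OF S(2)] by (simp add: at_within_open[OF S(2,1)])
  then show ?thesis
    using S by (rule has_derivative_transform_within_open) (rule g_eq)
qed

text \<open>
  On one fixed small ball all derivatives are given by the derived series, so the bounds on the
  derived coefficients yield the Cauchy-type bounds \<open>K L\<^sup>p p!\<close> there.
\<close>

lemma real_analytic_on_local_jets:
  fixes F :: "real ^ 'n \<Rightarrow> real"
  assumes "real_analytic_on F W" and "a \<in> W"
  shows "\<exists>s>0. \<exists>K\<ge>0. \<exists>L\<ge>0. \<forall>y\<in>ball a s. \<forall>ks.
    (iter_partial ks F has_derivative (\<lambda>h. \<Sum>k\<in>UNIV. h $ k * iter_partial (k # ks) F y)) (at y) \<and>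
    \<bar>iter_partial ks F y\<bar> \<le> K * L ^ length ks * fact (length ks)"
proof -
  obtain r c where "r > 0" and F: "\<And>y. y \<in> ball a r \<Longrightarrow>
      ((\<lambda>\<nu>. c \<nu> * multi_power (y - a) \<nu>) has_sum F y) UNIV"
    using assms unfolding real_analytic_on_def multi_power_def vector_minus_component by blast
  define \<rho> where "\<rho> = r / (2 * real CARD('n))"
  have card: "real CARD('n) \<ge> 1" by (simp add: Suc_leI)
  have \<rho>: "\<rho> > 0" using \<open>r > 0\<close> by (simp add: \<rho>_def)
  \<comment> \<open>Summability at a point with all coordinates at distance \<open>\<rho>\<close> from the centre bounds the
    coefficients; the choice of \<open>\<rho>\<close> keeps this point in the ball of convergence.\<close>
  define y\<^sub>0 where "y\<^sub>0 = a + (\<chi> i. \<rho>)"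
  have "norm (y\<^sub>0 - a) \<le> (\<Sum>i\<in>(UNIV :: 'n set). \<rho>)"
    using norm_le_l1_cart[of "y\<^sub>0 - a"] \<rho> by (simp add: y\<^sub>0_def)
  also have "\<dots> < r" using \<open>r > 0\<close> by (simp add: \<rho>_def)
  finally have "y\<^sub>0 \<in> ball a r" by (simp add: dist_norm norm_minus_commute)
  from F[OF this] have "(\<lambda>\<nu>. c \<nu> * \<rho> ^ (\<Sum>i\<in>UNIV. \<nu> i)) summable_on UNIV"
    unfolding summable_on_def by (auto simp: y\<^sub>0_def multi_power_def power_sum)
  then have abs_summable: "(\<lambda>\<nu>. norm (c \<nu> * \<rho> ^ (\<Sum>i\<in>UNIV. \<nu> i))) summable_on UNIV"
    by (subst (asm) summable_on_iff_abs_summable_on_real)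
  define M where "M = (\<Sum>\<^sub>\<infinity>\<nu>. norm (c \<nu> * \<rho> ^ (\<Sum>i\<in>UNIV. \<nu> i)))"
  have c: "\<bar>c \<nu>\<bar> \<le> M / \<rho> ^ (\<Sum>i\<in>UNIV. \<nu> i)" for \<nu>
  proof -
    have "norm (c \<nu> * \<rho> ^ (\<Sum>i\<in>UNIV. \<nu> i)) \<le> M"
      unfolding M_def using finite_sum_le_infsum[OF abs_summable, of "{\<nu>}"] by simp
    then show ?thesis using \<rho> by (simp add: abs_mult pos_le_divide_eq)
  qed
  define C where "C ks = foldr shift_coeff ks c" for ks
  have C_bound: "\<bar>C ks \<nu>\<bar> \<le> M * (2 / \<rho>) ^ length ks * fact (length ks) / (\<rho> / 2) ^ (\<Sum>i\<in>UNIV. \<nu> i)"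
    for ks \<nu>
    unfolding C_def by (rule foldr_shift_coeff_bound[OF \<rho> c])
  \<comment> \<open>The derived coefficients live on the radius \<open>\<rho> / 2\<close>, and \<open>has_derivative_power_series\<close> needs a
    quarter of the radius.\<close>
  define s where "s = (\<rho> / 2) / 4"
  have "s > 0" using \<rho> by (simp add: s_def)
  have "1 \<le> 2 * real CARD('n)" using card by linarith
  from mult_left_mono[OF this, of r] have "\<rho> \<le> r"
    using \<open>r > 0\<close> by (simp add: \<rho>_def pos_divide_le_eq)
  then have "ball a s \<subseteq> ball a r" using \<rho> by (intro subset_ball) (simp add: s_def)
  have half: "\<rho> / 2 > 0" using \<rho> by simp
  have deriv: "(power_series (C ks) a has_derivative
      (\<lambda>h. \<Sum>k\<in>UNIV. h $ k * power_series (C (k # ks)) a y)) (at y)" if "y \<in> ball a s" for ks y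
    using has_derivative_power_series[OF half C_bound[of ks] that[unfolded s_def]] by (simp add: C_def)
  have series: "iter_partial ks F y = power_series (C ks) a y" if "y \<in> ball a s" for ks y
    using that
  proof (induction ks arbitrary: y)
    case Nil
    with \<open>ball a s \<subseteq> ball a r\<close> have "y \<in> ball a r" by blast
    from infsumI[OF F[OF this]] show ?case
      by (simp add: iter_partial_simps power_series_def C_def)
  next
    case (Cons k ks)
    have "iter_partial (k # ks) F y = partial_deriv k (power_series (C ks) a) y"
      unfolding iter_partial_simps by (rule partial_deriv_cong[OF open_ball Cons.prems Cons.IH])
    also have "\<dots> = (\<Sum>j\<in>UNIV. axis k 1 $ j * power_series (C (j # ks)) a y)"
      by (rule partial_deriv_eqI[OF deriv[OF Cons.prems]])
    also have "\<dots> = (\<Sum>j\<in>UNIV. if j = k then power_series (C (j # ks)) a y else 0)"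
      by (rule sum.cong) (auto simp: axis_def)
    finally show ?case by simp
  qed
  define G where "G = (\<Sum>\<^sub>\<infinity>\<nu> :: 'n \<Rightarrow> nat. (1/2 :: real) ^ (\<Sum>i\<in>UNIV. \<nu> i))"
  have M: "M \<ge> 0" and G: "G \<ge> 0"
    unfolding M_def G_def by (simp_all add: infsum_nonneg)
  have "(iter_partial ks F has_derivative (\<lambda>h. \<Sum>k\<in>UNIV. h $ k * iter_partial (k # ks) F y)) (at y)"
    if y: "y \<in> ball a s" for ks y
    using has_derivative_transform_within_open[OF deriv[OF y] open_ball y series[symmetric]]
    by (simp add: series[OF y])
  moreover have "\<bar>iter_partial ks F y\<bar> \<le> (M * G) * (2 / \<rho>) ^ length ks * fact (length ks)"
    if y: "y \<in> ball a s" for ks y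
  proof -
    have "norm (y - a) \<le> (\<rho> / 2) / 2"
      using y \<rho> by (simp add: s_def dist_norm norm_minus_commute)
    from power_series_summable(3)[OF half C_bound[of ks] this] show ?thesis
      by (simp add: series[OF y] G_def mult_ac)
  qed
  moreover have "M * G \<ge> 0" "2 / \<rho> \<ge> 0" using M G \<rho> by simp_all
  ultimately show ?thesis using \<open>s > 0\<close> by blast
qed

lemma real_analytic_on_compact_jets:
  fixes F :: "real ^ 'n \<Rightarrow> real"
  assumes "real_analytic_on F W" and "compact S" and "S \<subseteq> W"
  shows "\<exists>K\<ge>0. \<exists>L\<ge>0. \<forall>y\<in>S. \<forall>ks.
    (iter_partial ks F has_derivative (\<lambda>h. \<Sum>k\<in>UNIV. h $ k * iter_partial (k # ks) F y)) (at y) \<and>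
    \<bar>iter_partial ks F y\<bar> \<le> K * L ^ length ks * fact (length ks)"
proof -
  let ?deriv = "\<lambda>ks y. (iter_partial ks F has_derivative
      (\<lambda>h. \<Sum>k\<in>UNIV. h $ k * iter_partial (k # ks) F y)) (at y)"
  have "\<forall>a\<in>S. \<exists>s K L. s > 0 \<and> K \<ge> 0 \<and> L \<ge> 0 \<and> (\<forall>y\<in>ball a s. \<forall>ks. ?deriv ks y \<and>
      \<bar>iter_partial ks F y\<bar> \<le> K * L ^ length ks * fact (length ks))"
    using real_analytic_on_local_jets[OF assms(1)] assms(3) by blast
  then obtain s K L where s: "\<And>a. a \<in> S \<Longrightarrow> s a > 0"
    and KL: "\<And>a. a \<in> S \<Longrightarrow> K a \<ge> 0" "\<And>a. a \<in> S \<Longrightarrow> L a \<ge> 0"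
    and jets: "\<And>a y ks. a \<in> S \<Longrightarrow> y \<in> ball a (s a) \<Longrightarrow> ?deriv ks y \<and>
      \<bar>iter_partial ks F y\<bar> \<le> K a * L a ^ length ks * fact (length ks)"
    unfolding bchoice_iff by blast
  have cover: "S \<subseteq> (\<Union>a\<in>S. ball a (s a))" using s by fastforce
  obtain T where T: "T \<subseteq> S" "finite T" "S \<subseteq> (\<Union>a\<in>T. ball a (s a))"
    by (rule compactE_image[OF assms(2) _ cover]) auto
  have "?deriv ks y \<and> \<bar>iter_partial ks F y\<bar> \<le> sum K T * sum L T ^ length ks * fact (length ks)"
    if "y \<in> S" for ks y
  proof -
    obtain a where a: "a \<in> T" "y \<in> ball a (s a)" using T(3) \<open>y \<in> S\<close> by blast
    then have "a \<in> S" using T(1) by blast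
    have "K a \<le> sum K T"
      by (rule member_le_sum) (use a(1) KL(1) T in auto)
    moreover have "L a \<le> sum L T"
      by (rule member_le_sum) (use a(1) KL(2) T in auto)
    ultimately have "K a * L a ^ length ks * fact (length ks) \<le> sum K T * sum L T ^ length ks * fact (length ks)"
      using KL[OF \<open>a \<in> S\<close>] by (intro mult_right_mono mult_mono power_mono) auto
    then show ?thesis
      using jets[OF \<open>a \<in> S\<close> a(2), of ks] by linarith
  qed
  moreover have "sum K T \<ge> 0" "sum L T \<ge> 0"
    using KL T(1) by (auto intro!: sum_nonneg)
  ultimately show ?thesis by blast
qed

section \<open>Derivatives of the flat functions \<open>exp (c * (1 - t powr - \<alpha>))\<close>\<close>

text \<open>
  For \<open>\<phi>(t) = exp (c (1 - t powr -\<alpha>))\<close> the \<open>n\<close>-th derivative is \<open>\<phi>\<close> times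
  \<open>\<Sum>\<^bsub>j\<le>n\<^esub> a\<^bsub>n,j\<^esub> t powr (-n - j \<alpha>)\<close>; the recursion for the \<open>a\<^bsub>n,j\<^esub>\<close> is read off from
  \<open>\<phi>'(t) = c \<alpha> t powr (-\<alpha> - 1) \<phi>(t)\<close> and the product rule.
\<close>

primrec flat_coeff :: "real \<Rightarrow> real \<Rightarrow> nat \<Rightarrow> nat \<Rightarrow> real" where
  "flat_coeff \<alpha> c 0 = (\<lambda>j. if j = 0 then 1 else 0)"
| "flat_coeff \<alpha> c (Suc n) = (\<lambda>j. - (real n + real j * \<alpha>) * flat_coeff \<alpha> c n j +
     (case j of 0 \<Rightarrow> 0 | Suc i \<Rightarrow> c * \<alpha> * flat_coeff \<alpha> c n i))"

definition flat_factor :: "real \<Rightarrow> real \<Rightarrow> nat \<Rightarrow> real \<Rightarrow> real" where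
  "flat_factor \<alpha> c n t = (\<Sum>j\<le>n. flat_coeff \<alpha> c n j * t powr (- real n - real j * \<alpha>))"

definition flat_deriv :: "real \<Rightarrow> real \<Rightarrow> nat \<Rightarrow> real \<Rightarrow> real" where
  "flat_deriv \<alpha> c n t = exp (c * (1 - t powr (- \<alpha>))) * flat_factor \<alpha> c n t"

lemma flat_coeff_eq_0: "n < j \<Longrightarrow> flat_coeff \<alpha> c n j = 0"
  by (induction n arbitrary: j) (auto split: nat.split)

lemma flat_deriv_0: "flat_deriv \<alpha> c 0 t = exp (c * (1 - t powr (- \<alpha>)))" if "t > 0"
  using that by (simp add: flat_deriv_def flat_factor_def)

lemma flat_factor_Suc:
  "flat_factor \<alpha> c (Suc n) t = (\<Sum>j\<le>n. flat_coeff \<alpha> c n j *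
      (- (real n + real j * \<alpha>) * t powr (- real n - real j * \<alpha> - 1) +
       c * \<alpha> * t powr (- real (Suc n) - real (Suc j) * \<alpha>)))"
proof -
  have exponent: "- real (Suc n) - real j * \<alpha> = - real n - real j * \<alpha> - 1" for j
    by simp
  have "flat_factor \<alpha> c (Suc n) t =
      (\<Sum>j\<le>Suc n. - (real n + real j * \<alpha>) * flat_coeff \<alpha> c n j * t powr (- real (Suc n) - real j * \<alpha>)) +
      (\<Sum>j\<le>Suc n. (case j of 0 \<Rightarrow> 0 | Suc i \<Rightarrow> c * \<alpha> * flat_coeff \<alpha> c n i) * t powr (- real (Suc n) - real j * \<alpha>))"
    by (simp only: flat_factor_def flat_coeff.simps distrib_right sum.distrib)
  also have "(\<Sum>j\<le>Suc n. - (real n + real j * \<alpha>) * flat_coeff \<alpha> c n j * t powr (- real (Suc n) - real j * \<alpha>)) =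
      (\<Sum>j\<le>n. - (real n + real j * \<alpha>) * flat_coeff \<alpha> c n j * t powr (- real n - real j * \<alpha> - 1))"
    unfolding exponent by (simp add: flat_coeff_eq_0)
  also have "(\<Sum>j\<le>Suc n. (case j of 0 \<Rightarrow> 0 | Suc i \<Rightarrow> c * \<alpha> * flat_coeff \<alpha> c n i) * t powr (- real (Suc n) - real j * \<alpha>)) =
      (\<Sum>j\<le>n. c * \<alpha> * flat_coeff \<alpha> c n j * t powr (- real (Suc n) - real (Suc j) * \<alpha>))"
    by (subst sum.atMost_Suc_shift) simp
  finally show ?thesis
    by (simp add: sum.distrib[symmetric] algebra_simps)
qed

lemma has_derivative_flat_deriv:
  assumes "t > 0"
  shows "(flat_deriv \<alpha> c n has_real_derivative flat_deriv \<alpha> c (Suc n) t) (at t)"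
proof -
  have "(flat_factor \<alpha> c n has_real_derivative
      (\<Sum>j\<le>n. flat_coeff \<alpha> c n j * ((- real n - real j * \<alpha>) * t powr (- real n - real j * \<alpha> - 1)))) (at t)"
    unfolding flat_factor_def[abs_def] using assms
    by (auto intro!: derivative_eq_intros has_real_derivative_powr sum.cong)
  moreover have "((\<lambda>t. exp (c * (1 - t powr (- \<alpha>)))) has_real_derivative
      exp (c * (1 - t powr (- \<alpha>))) * (c * \<alpha> * t powr (- \<alpha> - 1))) (at t)"
    using assms by (auto intro!: derivative_eq_intros has_real_derivative_powr)
  ultimately have "(flat_deriv \<alpha> c n has_real_derivative
      exp (c * (1 - t powr (- \<alpha>))) * (c * \<alpha> * t powr (- \<alpha> - 1)) * flat_factor \<alpha> c n t +
      (\<Sum>j\<le>n. flat_coeff \<alpha> c n j * ((- real n - real j * \<alpha>) * t powr (- real n - real j * \<alpha> - 1))) *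
        exp (c * (1 - t powr (- \<alpha>)))) (at t)"
    unfolding flat_deriv_def[abs_def] by (intro DERIV_mult)
  moreover have recursion: "c * \<alpha> * t powr (- \<alpha> - 1) * flat_factor \<alpha> c n t +
      (\<Sum>j\<le>n. flat_coeff \<alpha> c n j * ((- real n - real j * \<alpha>) * t powr (- real n - real j * \<alpha> - 1)))
      = flat_factor \<alpha> c (Suc n) t"
  proof -
    have "t powr (- \<alpha> - 1) * t powr (- real n - real j * \<alpha>) =
        t powr (- real (Suc n) - real (Suc j) * \<alpha>)" for j
      unfolding powr_add[symmetric] by (rule arg_cong[where f = "\<lambda>e. t powr e"]) (simp add: algebra_simps)
    then have "c * \<alpha> * t powr (- \<alpha> - 1) * flat_factor \<alpha> c n t =
        (\<Sum>j\<le>n. flat_coeff \<alpha> c n j * (c * \<alpha> * t powr (- real (Suc n) - real (Suc j) * \<alpha>)))"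
      by (simp add: flat_factor_def sum_distrib_left mult_ac flip: of_nat_Suc)
    then show ?thesis
      by (simp only: flat_factor_Suc sum.distrib distrib_left minus_add_distrib add.commute diff_conv_add_uminus)
  qed
  ultimately show ?thesis
    by (elim DERIV_cong) (simp only: flat_deriv_def[of _ _ "Suc n"] recursion[symmetric] distrib_left mult_ac)
qed

text \<open>
  The parameter \<open>\<delta>\<close> trades growth in \<open>n\<close> for growth in \<open>j\<close>. In the recursion, \<open>\<delta> ^ j / j!\<close> turns the
  second summand into \<open>j / \<delta>\<close> times the bound for the first, and \<open>j \<le> n + 1\<close> then leaves a factor
  \<open>(n + 1) D\<close>.
\<close>

lemma flat_coeff_bound:
  assumes "\<alpha> > 0" and "\<delta> > 0" and D: "D \<ge> 1 + \<alpha> + \<bar>c\<bar> * \<alpha> / \<delta>"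
  shows "\<bar>flat_coeff \<alpha> c n j\<bar> \<le> D ^ n * fact n * (\<delta> ^ j / fact j)"
proof (induction n arbitrary: j)
  case 0
  then show ?case using assms(2) by simp
next
  case (Suc n)
  have D1: "D \<ge> 0" using assms by (smt (verit) divide_nonneg_pos mult_nonneg_nonneg)
  define W where "W = D ^ n * fact n * (\<delta> ^ j / fact j)"
  have W: "W \<ge> 0" using D1 assms by (simp add: W_def)
  show ?case
  proof (cases "j \<le> Suc n")
    case False
    then show ?thesis
      using D1 assms(2) by (simp add: flat_coeff_eq_0 del: flat_coeff.simps)
  next
    case True
    have "\<bar>- (real n + real j * \<alpha>) * flat_coeff \<alpha> c n j\<bar> \<le> (real n + real j * \<alpha>) * W"
      unfolding abs_mult abs_minus_cancel W_def using assms(1) Suc.IH[of j]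
      by (intro mult_mono) auto
    moreover have "\<bar>case j of 0 \<Rightarrow> 0 | Suc i \<Rightarrow> c * \<alpha> * flat_coeff \<alpha> c n i\<bar> \<le> \<bar>c\<bar> * \<alpha> / \<delta> * real j * W"
    proof (cases j)
      case (Suc i)
      have "\<bar>c * \<alpha> * flat_coeff \<alpha> c n i\<bar> \<le> \<bar>c\<bar> * \<alpha> * (D ^ n * fact n * (\<delta> ^ i / fact i))"
        unfolding abs_mult using assms(1) Suc.IH[of i] by (intro mult_mono) auto
      also have "\<dots> = \<bar>c\<bar> * \<alpha> / \<delta> * real j * W"
      proof -
        have "\<delta> ^ i / fact i = real j / \<delta> * (\<delta> ^ j / fact j)"
          using assms(2) Suc by (simp add: field_simps del: of_nat_Suc)
        then show ?thesis
          unfolding W_def by (simp only: divide_inverse mult_ac)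
      qed
      finally show ?thesis
        using Suc by simp
    qed simp
    ultimately have "\<bar>flat_coeff \<alpha> c (Suc n) j\<bar> \<le> (real n + real j * (\<alpha> + \<bar>c\<bar> * \<alpha> / \<delta>)) * W"
      by (simp add: algebra_simps)
    also have "\<dots> \<le> (real (Suc n) + real (Suc n) * (\<alpha> + \<bar>c\<bar> * \<alpha> / \<delta>)) * W"
      using True assms(1,2) W by (intro mult_right_mono add_mono) auto
    also have "\<dots> = real (Suc n) * (1 + \<alpha> + \<bar>c\<bar> * \<alpha> / \<delta>) * W"
      by (simp add: algebra_simps)
    also have "\<dots> \<le> real (Suc n) * D * W"
      using W D by (intro mult_right_mono mult_left_mono) auto
    also have "\<dots> = D ^ Suc n * fact (Suc n) * (\<delta> ^ j / fact j)"
      by (simp add: W_def mult_ac)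
    finally show ?thesis .
  qed
qed

lemma flat_coeff_constant: "n > 0 \<Longrightarrow> flat_coeff \<alpha> 0 n j = 0"
proof (induction n arbitrary: j)
  case (Suc n)
  then show ?case by (cases n) (auto split: nat.split)
qed simp

lemma sum_power_fact_le_exp:
  assumes "(x::real) \<ge> 0"
  shows "(\<Sum>j\<le>n. x ^ j / fact j) \<le> exp x"
proof -
  have "(\<Sum>j<Suc n. x ^ j /\<^sub>R fact j) \<le> exp x"
    unfolding exp_def using assms by (intro sum_le_suminf summable_exp_generic) auto
  then show ?thesis by (simp add: lessThan_Suc_atMost field_simps)
qed

text \<open>
  Summing the coefficient bounds produces a partial sum of the series of \<open>exp (\<delta> t powr -\<alpha>)\<close>.
\<close>

lemma flat_factor_bound:
  assumes "\<alpha> > 0" and "\<delta> > 0" and D: "D \<ge> 1 + \<alpha> + \<bar>c\<bar> * \<alpha> / \<delta>" and "t > 0"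
  shows "\<bar>flat_factor \<alpha> c n t\<bar> \<le> D ^ n * fact n * t powr (- real n) * exp (\<delta> * t powr (- \<alpha>))"
proof -
  have D0: "D \<ge> 0" using assms by (smt (verit) divide_nonneg_pos mult_nonneg_nonneg)
  have "\<bar>flat_factor \<alpha> c n t\<bar> \<le> (\<Sum>j\<le>n. \<bar>flat_coeff \<alpha> c n j * t powr (- real n - real j * \<alpha>)\<bar>)"
    unfolding flat_factor_def by (rule sum_abs)
  also have "\<dots> \<le> (\<Sum>j\<le>n. D ^ n * fact n * t powr (- real n) * ((\<delta> * t powr (- \<alpha>)) ^ j / fact j))"
  proof (rule sum_mono)
    fix j
    have "\<bar>flat_coeff \<alpha> c n j * t powr (- real n - real j * \<alpha>)\<bar>
        \<le> D ^ n * fact n * (\<delta> ^ j / fact j) * t powr (- real n - real j * \<alpha>)"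
      unfolding abs_mult using flat_coeff_bound[OF assms(1-3), of n j] by (intro mult_mono) auto
    also have "\<dots> = D ^ n * fact n * t powr (- real n) * ((\<delta> * t powr (- \<alpha>)) ^ j / fact j)"
    proof -
      have "t powr (- real n - real j * \<alpha>) = t powr (- real n) * (t powr (- \<alpha>)) ^ j"
        using assms(4) by (simp add: powr_powr powr_add[symmetric] mult_ac flip: powr_realpow)
      then show ?thesis by (simp add: power_mult_distrib)
    qed
    finally show "\<bar>flat_coeff \<alpha> c n j * t powr (- real n - real j * \<alpha>)\<bar>
        \<le> D ^ n * fact n * t powr (- real n) * ((\<delta> * t powr (- \<alpha>)) ^ j / fact j)" .
  qed
  also have "\<dots> = D ^ n * fact n * t powr (- real n) * (\<Sum>j\<le>n. (\<delta> * t powr (- \<alpha>)) ^ j / fact j)"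
    by (simp add: sum_distrib_left)
  also have "\<dots> \<le> D ^ n * fact n * t powr (- real n) * exp (\<delta> * t powr (- \<alpha>))"
    using D0 assms by (intro mult_left_mono sum_power_fact_le_exp) auto
  finally show ?thesis .
qed

text \<open>
  This is the source of the exponent \<open>1/\<alpha>\<close>: with \<open>u = t powr -\<alpha>\<close> the left-hand side is
  \<open>(u ^ n) powr (1/\<alpha>)\<close>, and \<open>(\<alpha> \<delta> u) ^ n / n! \<le> exp (\<alpha> \<delta> u)\<close>.
\<close>

lemma powr_minus_le_fact_exp:
  assumes "\<alpha> > 0" and "\<delta> > 0" and "t > 0"
  shows "t powr (- real n) \<le>
    ((\<alpha> * \<delta>) powr (- 1 / \<alpha>)) ^ n * fact n powr (1 / \<alpha>) * exp (\<delta> * t powr (- \<alpha>))"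
proof -
  define u where "u = t powr (- \<alpha>)"
  have u: "u > 0" using assms by (simp add: u_def)
  have "(\<alpha> * \<delta> * u) ^ n / fact n \<le> (\<Sum>j\<le>n. (\<alpha> * \<delta> * u) ^ j / fact j)"
    by (rule member_le_sum) (use assms u in auto)
  also have "\<dots> \<le> exp (\<alpha> * \<delta> * u)"
    using assms u by (intro sum_power_fact_le_exp) auto
  finally have "u ^ n \<le> (1 / (\<alpha> * \<delta>)) ^ n * fact n * exp (\<alpha> * \<delta> * u)"
    using assms by (simp add: field_simps)
  then have "(u ^ n) powr (1 / \<alpha>) \<le> ((1 / (\<alpha> * \<delta>)) ^ n * fact n * exp (\<alpha> * \<delta> * u)) powr (1 / \<alpha>)"
    using assms u by (intro powr_mono2) auto
  also have "\<dots> = ((1 / (\<alpha> * \<delta>)) ^ n) powr (1 / \<alpha>) * fact n powr (1 / \<alpha>) * exp (\<delta> * u)"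
    using assms by (simp add: powr_mult exp_powr_real)
  also have "((1 / (\<alpha> * \<delta>)) ^ n) powr (1 / \<alpha>) = ((\<alpha> * \<delta>) powr (- 1 / \<alpha>)) ^ n"
    using assms by (simp add: powr_powr powr_divide powr_minus_divide mult.commute flip: powr_realpow)
  also have "(u ^ n) powr (1 / \<alpha>) = t powr (- real n)"
    using assms u by (simp add: u_def powr_powr flip: powr_realpow)
  finally show ?thesis by (simp add: u_def)
qed

lemma flat_factor_gevrey:
  assumes "\<alpha> > 0" and "\<delta> > 0" and D: "D \<ge> 1 + \<alpha> + \<bar>c\<bar> * \<alpha> / \<delta>" and "t > 0"
  shows "\<bar>flat_factor \<alpha> c n t\<bar> \<le>
    (D * (\<alpha> * \<delta>) powr (- 1 / \<alpha>)) ^ n * fact n powr (1 / \<alpha> + 1) * exp (2 * \<delta> * t powr (- \<alpha>))"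
proof -
  have D0: "D \<ge> 0" using assms by (smt (verit) divide_nonneg_pos mult_nonneg_nonneg)
  have "\<bar>flat_factor \<alpha> c n t\<bar> \<le> D ^ n * fact n * t powr (- real n) * exp (\<delta> * t powr (- \<alpha>))"
    by (rule flat_factor_bound[OF assms])
  also have "\<dots> \<le> D ^ n * fact n * (((\<alpha> * \<delta>) powr (- 1 / \<alpha>)) ^ n * fact n powr (1 / \<alpha>) *
      exp (\<delta> * t powr (- \<alpha>))) * exp (\<delta> * t powr (- \<alpha>))"
    using D0 by (intro mult_right_mono mult_left_mono powr_minus_le_fact_exp[OF assms(1,2,4)]) auto
  also have "exp (2 * \<delta> * t powr (- \<alpha>)) = exp (\<delta> * t powr (- \<alpha>)) * exp (\<delta> * t powr (- \<alpha>))"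
    by (simp flip: exp_add)
  then have "D ^ n * fact n * (((\<alpha> * \<delta>) powr (- 1 / \<alpha>)) ^ n * fact n powr (1 / \<alpha>) *
      exp (\<delta> * t powr (- \<alpha>))) * exp (\<delta> * t powr (- \<alpha>)) =
      (D * (\<alpha> * \<delta>) powr (- 1 / \<alpha>)) ^ n * fact n powr (1 / \<alpha> + 1) * exp (2 * \<delta> * t powr (- \<alpha>))"
    by (simp only: power_mult_distrib powr_add powr_one_gt_zero_iff powr_one fact_gt_zero less_imp_le mult_ac)
  finally show ?thesis .
qed

section \<open>Bounded monomials after the substitution\<close>

lemma open_unit_cube: "open (unit_cube :: (real ^ 'm) set)"
proof -
  have "unit_cube = (\<Inter>i\<in>UNIV. {x :: real ^ 'm. 0 < x $ i} \<inter> {x. x $ i < 1})"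
    by (auto simp: unit_cube_def)
  also have "open \<dots>"
    by (intro open_INT ballI open_Int open_Collect_less continuous_intros finite)
  finally show ?thesis .
qed

lemma open_P_map_preimage:
  assumes "open U"
  shows "open {x \<in> unit_cube. P_map \<alpha> x \<in> U}"
proof -
  have "continuous_on unit_cube (P_map \<alpha> :: real ^ 'm \<Rightarrow> real ^ 'm)"
    unfolding P_map_def P1_def unit_cube_def
    by (intro continuous_intros ballI) (metis (mono_tags) less_irrefl mem_Collect_eq)
  from continuous_open_preimage[OF this open_unit_cube assms] show ?thesis
    by (simp add: vimage_def Int_def)
qed

lemma partial_deriv_monomial:
  assumes "\<And>k. x $ k > 0"
  shows "partial_deriv i (monomial \<mu>) x = \<mu> $ i * monomial \<mu> x / x $ i"
proof -
  have "partial_deriv i (monomial \<mu>) x =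
      (\<mu> $ i * x $ i powr (\<mu> $ i - 1)) * (\<Prod>j\<in>UNIV - {i}. x $ j powr (\<mu> $ j))"
    unfolding monomial_def[abs_def]
    by (rule partial_deriv_tensor) (use assms in \<open>auto intro!: has_real_derivative_powr\<close>)
  also have "\<dots> = \<mu> $ i * (x $ i powr (\<mu> $ i) * (\<Prod>j\<in>UNIV - {i}. x $ j powr (\<mu> $ j))) / x $ i"
    using assms[of i] by (simp add: powr_diff)
  also have "x $ i powr (\<mu> $ i) * (\<Prod>j\<in>UNIV - {i}. x $ j powr (\<mu> $ j)) = monomial \<mu> x"
    unfolding monomial_def by (rule prod.remove[symmetric]) auto
  finally show ?thesis .
qed

lemma monomial_P_map:
  "monomial \<mu> (P_map \<alpha> x) = (\<Prod>k\<in>UNIV. exp (\<mu> $ k * (1 - x $ k powr (- \<alpha>))))"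
  by (simp add: monomial_def P_map_def P1_def exp_powr_real mult.commute)

lemma prod_fact_le_fact_sum: "finite S \<Longrightarrow> (\<Prod>k\<in>S. fact (f k) :: real) \<le> fact (\<Sum>k\<in>S. f k)"
proof (induction S rule: finite_induct)
  case (insert k S)
  then have "(\<Prod>k\<in>insert k S. fact (f k) :: real) \<le> fact (f k) * fact (\<Sum>k\<in>S. f k)"
    by simp
  also have "\<dots> \<le> fact (\<Sum>k\<in>insert k S. f k)"
    using insert fact_mult_le_fact_add by simp
  finally show ?case .
qed simp

text \<open>
  The heart of the matter. Multiplying the \<open>m\<close> decay assumptions (or the plain bound, for coordinates
  with exponent \<open>0\<close>) gives \<open>(h \<cdot> \<Prod>\<^sub>k g\<^sub>k)\<^sup>m \<le> M\<^sup>m\<close> with \<open>g\<^sub>k = exp (x\<^sub>k powr -\<alpha> / m)\<close>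
  (or \<open>g\<^sub>k = 1\<close>, respectively). So \<open>h\<close> absorbs one factor \<open>exp (x\<^sub>k powr -\<alpha> / m)\<close> for every coordinate
  with nonzero exponent, which is exactly the loss in
  \<open>flat_factor_gevrey\<close> for \<open>\<delta> = 1 / (2 m)\<close>.
\<close>

lemma jet_bound_monomial_P_map:
  fixes \<mu> :: "real ^ 'm"
  assumes "\<alpha> > 0" and "open V" and V: "V \<subseteq> unit_cube" and "M \<ge> 0"
    and bound: "\<And>x. x \<in> V \<Longrightarrow> monomial \<mu> (P_map \<alpha> x) \<le> M"
    and decay: "\<And>x k. x \<in> V \<Longrightarrow> \<mu> $ k \<noteq> 0 \<Longrightarrow>
      monomial \<mu> (P_map \<alpha> x) \<le> M * exp (- (x $ k powr (- \<alpha>)))"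
  shows "\<exists>A>0. \<forall>N. jet_bound V N (\<lambda>x. monomial \<mu> (P_map \<alpha> x))
    (\<lambda>n. M * A ^ n * fact n powr (1 / \<alpha> + 1))"
proof -
  define m where "m = CARD('m)"
  have m: "m > 0" by (simp add: m_def)
  define \<delta> where "\<delta> = 1 / (2 * real m)"
  have \<delta>: "\<delta> > 0" using m by (simp add: \<delta>_def)
  define D where "D = 1 + \<alpha> + (\<Sum>k\<in>UNIV. \<bar>\<mu> $ k\<bar>) * \<alpha> / \<delta>"
  have D_ge: "D \<ge> 1 + \<alpha> + \<bar>\<mu> $ k\<bar> * \<alpha> / \<delta>" for k
  proof -
    have "\<bar>\<mu> $ k\<bar> \<le> (\<Sum>k\<in>UNIV. \<bar>\<mu> $ k\<bar>)" by (rule member_le_sum) auto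
    then show ?thesis
      using assms(1) \<delta> by (simp add: D_def divide_right_mono mult_right_mono)
  qed
  have "D > 0"
    using assms(1) \<delta> by (auto simp: D_def intro!: add_pos_nonneg divide_nonneg_pos mult_nonneg_nonneg sum_nonneg)
  define A where "A = D * (\<alpha> * \<delta>) powr (- 1 / \<alpha>)"
  have A: "A > 0" using \<open>D > 0\<close> assms(1) \<delta> by (simp add: A_def)
  define E where "E k = flat_deriv \<alpha> (\<mu> $ k)" for k
  have pos: "x $ k > 0" if "x \<in> V" for x k
    using V that by (auto simp: unit_cube_def)
  have E: "(E k n has_real_derivative E k (Suc n) (x $ k)) (at (x $ k))" if "x \<in> V" for x k n
    unfolding E_def using pos[OF that] by (rule has_derivative_flat_deriv)
  have tensor: "monomial \<mu> (P_map \<alpha> x) = (\<Prod>k\<in>UNIV. E k 0 (x $ k))" if "x \<in> V" for x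
    unfolding monomial_P_map E_def by (rule prod.cong) (simp_all add: flat_deriv_0 pos[OF that])
  have E_bound: "\<bar>\<Prod>k\<in>UNIV. E k (f k) (x $ k)\<bar> \<le>
      M * A ^ (\<Sum>k\<in>UNIV. f k) * fact (\<Sum>k\<in>UNIV. f k) powr (1 / \<alpha> + 1)" if x: "x \<in> V" for x f
  \<comment> \<open>A derivative in a direction whose exponent is \<open>0\<close> vanishes; no decay in that coordinate is
    available, so this case has to be split off.\<close>
  proof (cases "\<exists>k. \<mu> $ k = 0 \<and> f k > 0")
    case True
    then obtain k where k: "\<mu> $ k = 0" "f k > 0" by blast
    then have "E k (f k) (x $ k) = 0"
      by (simp add: E_def flat_deriv_def flat_factor_def flat_coeff_constant)
    then have "(\<Prod>k\<in>UNIV. E k (f k) (x $ k)) = 0"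
      by (intro prod_zero) auto
    then show ?thesis using A \<open>M \<ge> 0\<close> by (simp del: prod_zero_iff)
  next
    case False
    define h where "h = monomial \<mu> (P_map \<alpha> x)"
    have h0: "h \<ge> 0" by (simp add: h_def monomial_P_map prod_nonneg)
    define g where "g k = (if \<mu> $ k = 0 then 1 else exp (x $ k powr (- \<alpha>) / m))" for k
    have g0: "g k > 0" for k by (simp add: g_def)
    have "(h * (\<Prod>k\<in>UNIV. g k)) ^ m = (\<Prod>k\<in>UNIV. h * g k ^ m)"
      by (simp add: m_def power_mult_distrib prod.distrib prod_power_distrib)
    also have "\<dots> \<le> (\<Prod>k\<in>(UNIV :: 'm set). M)"
    proof (rule prod_mono, intro conjI)
      fix k
      show "0 \<le> h * g k ^ m" using h0 g0[of k] by simp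
      show "h * g k ^ m \<le> M"
      proof (cases "\<mu> $ k = 0")
        case True
        then show ?thesis using bound[OF x] by (simp add: g_def h_def)
      next
        case False
        then have "g k ^ m = exp (x $ k powr (- \<alpha>))"
          using m by (simp add: g_def flip: exp_of_nat_mult)
        then show ?thesis
          using mult_right_mono[OF decay[OF x False], of "g k ^ m"]
          by (simp add: h_def mult.assoc flip: exp_add)
      qed
    qed
    also have "\<dots> = M ^ m" by (simp add: m_def)
    finally have hg: "h * (\<Prod>k\<in>UNIV. g k) \<le> M"
      using power_le_imp_le_base[of "h * (\<Prod>k\<in>UNIV. g k)" "m - 1" M] \<open>M \<ge> 0\<close> m by simp
    have Q: "\<bar>flat_factor \<alpha> (\<mu> $ k) (f k) (x $ k)\<bar> \<le> A ^ f k * fact (f k) powr (1 / \<alpha> + 1) * g k" for k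
    proof (cases "\<mu> $ k = 0")
      case True
      with False have "f k = 0" by simp
      then show ?thesis using True pos[OF x, of k] by (simp add: g_def flat_factor_def)
    next
      case False
      then show ?thesis
        using flat_factor_gevrey[OF assms(1) \<delta> D_ge pos[OF x, of k], of k "f k"]
        by (simp add: A_def g_def \<delta>_def)
    qed
    have "\<bar>\<Prod>k\<in>UNIV. E k (f k) (x $ k)\<bar> = h * (\<Prod>k\<in>UNIV. \<bar>flat_factor \<alpha> (\<mu> $ k) (f k) (x $ k)\<bar>)"
      by (simp add: E_def flat_deriv_def h_def monomial_P_map abs_mult abs_prod prod.distrib)
    also have "\<dots> \<le> h * (\<Prod>k\<in>UNIV. A ^ f k * fact (f k) powr (1 / \<alpha> + 1) * g k)"
      by (intro mult_left_mono h0 prod_mono) (use Q in auto)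
    also have "\<dots> = (h * (\<Prod>k\<in>UNIV. g k)) *
        (A ^ (\<Sum>k\<in>UNIV. f k) * (\<Prod>k\<in>UNIV. fact (f k)) powr (1 / \<alpha> + 1))"
      by (simp add: prod.distrib power_sum prod_powr_distrib)
    also have "\<dots> \<le> M * (A ^ (\<Sum>k\<in>UNIV. f k) * fact (\<Sum>k\<in>UNIV. f k) powr (1 / \<alpha> + 1))"
      using A \<open>\<alpha> > 0\<close> \<open>M \<ge> 0\<close>
      by (intro mult_mono hg powr_mono2 prod_fact_le_fact_sum) (auto intro: prod_nonneg)
    finally show ?thesis by (simp add: mult_ac)
  qed
  have "jet_bound V N (\<lambda>x. \<Prod>k\<in>UNIV. E k 0 (x $ k)) (\<lambda>n. M * A ^ n * fact n powr (1 / \<alpha> + 1))" for N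
    unfolding jet_bound_def
  proof (intro allI impI ballI conjI)
    fix "is" :: "'m list" and x assume x: "x \<in> V"
    have eq: "iter_partial is (\<lambda>x. \<Prod>k\<in>UNIV. E k 0 (x $ k)) y = (\<Prod>k\<in>UNIV. E k (count_list is k) (y $ k))"
      if "y \<in> V" for y
      by (rule iter_partial_tensor[where E = E, OF assms(2) E that])
    show "iter_partial is (\<lambda>x. \<Prod>k\<in>UNIV. E k 0 (x $ k)) differentiable (at x)"
      using has_derivative_transform_within_open[OF has_derivative_tensor[of "\<lambda>k. E k (count_list is k)", OF E[OF x]]
          assms(2) x eq[symmetric]] by (rule differentiableI)
    show "\<bar>iter_partial is (\<lambda>x. \<Prod>k\<in>UNIV. E k 0 (x $ k)) x\<bar>
        \<le> M * A ^ length is * fact (length is) powr (1 / \<alpha> + 1)"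
      using E_bound[OF x, of "count_list is"] by (simp add: eq[OF x] sum_count_list_UNIV)
  qed
  then have "jet_bound V N (\<lambda>x. monomial \<mu> (P_map \<alpha> x)) (\<lambda>n. M * A ^ n * fact n powr (1 / \<alpha> + 1))" for N
    by (rule jet_bound_cong[OF assms(2), rotated]) (rule tensor)
  with A show ?thesis by blast
qed

text \<open>
  The derivative of the monomial in direction \<open>i\<close> is \<open>\<mu>\<^sub>i y\<^sup>\<mu> / y\<^sub>i\<close>. Bounding it amounts to
  \<open>y\<^sup>\<mu> \<le> const \<cdot> y\<^sub>i\<close>, and at \<open>y = P(x)\<close> the right-hand side is \<open>const \<cdot> exp (1 - x\<^sub>i powr -\<alpha>)\<close>.
\<close>

lemma jet_bound_bounded_monomial:
  fixes b :: "real ^ 'm \<Rightarrow> real"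
  assumes "\<alpha> > 0" and "open U" and "U \<subseteq> unit_cube"
    and b: "bounded_monomial U b"
    and b_deriv: "\<And>i. bounded (partial_deriv i b ` U)"
  shows "\<exists>A>0. \<exists>B\<ge>0. \<forall>N. jet_bound {x \<in> unit_cube. P_map \<alpha> x \<in> U} N (\<lambda>x. b (P_map \<alpha> x))
    (\<lambda>n. B * A ^ n * fact n powr (1 / \<alpha> + 1))"
proof -
  define V where "V = {x \<in> unit_cube. P_map \<alpha> x \<in> U}"
  have V: "open V" unfolding V_def by (rule open_P_map_preimage[OF assms(2)])
  show ?thesis
  proof (cases "\<forall>x\<in>U. b x = 0")
    case True
    have "jet_bound V N (\<lambda>x. b (P_map \<alpha> x)) (\<lambda>n. 0)" for N
      by (rule jet_bound_cong[OF V _ jet_bound_zero]) (use True in \<open>simp add: V_def\<close>)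
    then show ?thesis
      unfolding V_def by - (rule exI, rule conjI, rule zero_less_one, rule exI[of _ 0], simp)
  next
    case False
    with b obtain \<mu> where \<mu>: "\<And>x. x \<in> U \<Longrightarrow> b x = monomial \<mu> x" and "bounded (b ` U)"
      unfolding bounded_monomial_def by blast
    then obtain B\<^sub>0 where B\<^sub>0: "\<And>x. x \<in> U \<Longrightarrow> \<bar>b x\<bar> \<le> B\<^sub>0"
      unfolding bounded_iff real_norm_def by blast
    have "\<forall>i. \<exists>B. \<forall>x\<in>U. \<bar>partial_deriv i b x\<bar> \<le> B"
      using b_deriv unfolding bounded_iff by auto
    then obtain B\<^sub>1 where B\<^sub>1: "\<And>i x. x \<in> U \<Longrightarrow> \<bar>partial_deriv i b x\<bar> \<le> B\<^sub>1 i"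
      by metis
    have U_pos: "y $ i > 0" if "y \<in> U" for y i
      using that assms(3) by (auto simp: unit_cube_def)
    \<comment> \<open>Directions with \<open>\<mu> $ i = 0\<close> contribute \<open>0\<close> to the sum, as division by zero yields zero.\<close>
    define M where "M = \<bar>B\<^sub>0\<bar> + (\<Sum>i\<in>UNIV. \<bar>B\<^sub>1 i / \<mu> $ i\<bar> * exp 1)"
    have M: "M \<ge> 0" by (auto simp: M_def intro!: add_nonneg_nonneg sum_nonneg)
    have "\<exists>A>0. \<forall>N. jet_bound V N (\<lambda>x. monomial \<mu> (P_map \<alpha> x))
      (\<lambda>n. M * A ^ n * fact n powr (1 / \<alpha> + 1))"
    proof (rule jet_bound_monomial_P_map[OF assms(1) V _ M])
      show "V \<subseteq> unit_cube" by (auto simp: V_def)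
      show "monomial \<mu> (P_map \<alpha> x) \<le> M" if "x \<in> V" for x
      proof -
        have "monomial \<mu> (P_map \<alpha> x) \<le> B\<^sub>0"
          using that \<mu> B\<^sub>0 by (fastforce simp: V_def)
        also have "\<dots> \<le> M"
          unfolding M_def by (rule order_trans[OF abs_ge_self]) (simp add: sum_nonneg)
        finally show ?thesis .
      qed
      show "monomial \<mu> (P_map \<alpha> x) \<le> M * exp (- (x $ i powr (- \<alpha>)))"
        if x: "x \<in> V" and i: "\<mu> $ i \<noteq> 0" for x i
      proof -
        define y where "y = P_map \<alpha> x"
        have y: "y \<in> U" using x by (simp add: V_def y_def)
        have "partial_deriv i b y = partial_deriv i (monomial \<mu>) y"
          using assms(2) y \<mu> by (rule partial_deriv_cong)
        also have "\<dots> = \<mu> $ i * monomial \<mu> y / y $ i"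
          by (rule partial_deriv_monomial) (rule U_pos[OF y])
        finally have "\<bar>\<mu> $ i * monomial \<mu> y / y $ i\<bar> \<le> B\<^sub>1 i"
          using B\<^sub>1[OF y, of i] by simp
        then have "\<bar>\<mu> $ i\<bar> * \<bar>monomial \<mu> y\<bar> \<le> B\<^sub>1 i * y $ i"
          using U_pos[OF y, of i] by (simp add: abs_mult pos_divide_le_eq)
        then have "\<bar>monomial \<mu> y\<bar> \<le> B\<^sub>1 i / \<bar>\<mu> $ i\<bar> * y $ i"
          using i by (simp add: field_simps)
        also have "\<dots> \<le> \<bar>B\<^sub>1 i / \<mu> $ i\<bar> * y $ i"
          using U_pos[OF y, of i] by (intro mult_right_mono) (auto simp: abs_divide divide_right_mono)
        finally have "monomial \<mu> y \<le> \<bar>B\<^sub>1 i / \<mu> $ i\<bar> * y $ i" by linarith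
        also have "y $ i = exp 1 * exp (- (x $ i powr (- \<alpha>)))"
          by (simp add: y_def P_map_def P1_def flip: exp_add)
        also have "\<bar>B\<^sub>1 i / \<mu> $ i\<bar> * (exp 1 * exp (- (x $ i powr (- \<alpha>)))) \<le> M * exp (- (x $ i powr (- \<alpha>)))"
        proof -
          have "\<bar>B\<^sub>1 i / \<mu> $ i\<bar> * exp 1 \<le> (\<Sum>i\<in>UNIV. \<bar>B\<^sub>1 i / \<mu> $ i\<bar> * exp 1)"
            by (rule member_le_sum) auto
          then have "\<bar>B\<^sub>1 i / \<mu> $ i\<bar> * exp 1 \<le> M" by (simp add: M_def)
          then show ?thesis
            unfolding mult.assoc[symmetric] by (rule mult_right_mono) simp
        qed
        finally show ?thesis by (simp add: y_def)
      qed
    qed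
    then obtain A where A: "A > 0" and jet:
      "\<And>N. jet_bound V N (\<lambda>x. monomial \<mu> (P_map \<alpha> x)) (\<lambda>n. M * A ^ n * fact n powr (1 / \<alpha> + 1))"
      by blast
    have "jet_bound V N (\<lambda>x. b (P_map \<alpha> x)) (\<lambda>n. M * A ^ n * fact n powr (1 / \<alpha> + 1))" for N
      by (rule jet_bound_cong[OF V _ jet]) (simp add: V_def \<mu>)
    with A M show ?thesis unfolding V_def by blast
  qed
qed

lemma bounded_monomial_map_imp_bounded:
  fixes b :: "real ^ 'm \<Rightarrow> real ^ 'n"
  assumes "bounded_monomial_map U b"
  shows "bounded (b ` U)"
proof -
  have "\<forall>k. \<exists>B. \<forall>x\<in>U. \<bar>b x $ k\<bar> \<le> B"
  proof
    fix k
    show "\<exists>B. \<forall>x\<in>U. \<bar>b x $ k\<bar> \<le> B"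
    proof (cases "\<forall>x\<in>U. b x $ k = 0")
      case False
      with assms have "bounded ((\<lambda>x. b x $ k) ` U)"
        unfolding bounded_monomial_map_def bounded_monomial_def by blast
      then show ?thesis unfolding bounded_iff by simp
    qed auto
  qed
  then obtain B where "\<And>k x. x \<in> U \<Longrightarrow> \<bar>b x $ k\<bar> \<le> B k"
    unfolding choice_iff by blast
  then have "norm (b x) \<le> (\<Sum>k\<in>UNIV. B k)" if "x \<in> U" for x
    using that by (intro order_trans[OF norm_le_l1_cart] sum_mono)
  then show ?thesis by (auto simp: bounded_iff)
qed

section \<open>Mildness of the composition\<close>

theorem theorem4p3:
  fixes \<alpha> :: real
    and U :: "(real ^ 'm) set"
    and f :: "real ^ 'm \<Rightarrow> real"
    and b :: "real ^ 'm \<Rightarrow> real ^ 'n"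
  assumes "\<alpha> > 0"
    and "open U" and "U \<subseteq> unit_cube"
    and "abm U b f"
    and "\<And>k i. bounded (partial_deriv i (\<lambda>x. b x $ k) ` U)"
  shows "C_mild (1 / \<alpha>) {x \<in> unit_cube. P_map \<alpha> x \<in> U} (f \<circ> P_map \<alpha>)"
proof -
  define V where "V = {x \<in> unit_cube. P_map \<alpha> x \<in> U}"
  have V: "open V" unfolding V_def by (rule open_P_map_preimage[OF assms(2)])
  define C where "C = 1 / \<alpha>"
  have C: "C \<ge> 0" using assms(1) by (simp add: C_def)
  obtain j F W where b: "bounded_monomial_map U b" and W: "closure (b ` U) \<subseteq> W"
    and F: "real_analytic_on F W" and f: "\<And>x. x \<in> U \<Longrightarrow> f x = b x $ j * F (b x)"
    using assms(4) unfolding abm_def unit_on_def by blast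
  have "compact (closure (b ` U))"
    using bounded_monomial_map_imp_bounded[OF b] by (simp add: compact_closure)
  from real_analytic_on_compact_jets[OF F this W] obtain K L where KL: "K \<ge> 0" "L \<ge> 0"
    and F_deriv: "\<And>ks y. y \<in> closure (b ` U) \<Longrightarrow>
      (iter_partial ks F has_derivative (\<lambda>h. \<Sum>k\<in>UNIV. h $ k * iter_partial (k # ks) F y)) (at y)"
    and F_bound: "\<And>ks y. y \<in> closure (b ` U) \<Longrightarrow>
      \<bar>iter_partial ks F y\<bar> \<le> K * L ^ length ks * fact (length ks)"
    by blast
  have "\<forall>k. \<exists>A B. A > 0 \<and> B \<ge> 0 \<and>
    (\<forall>N. jet_bound V N (\<lambda>x. b (P_map \<alpha> x) $ k) (\<lambda>n. B * A ^ n * fact n powr (C + 1)))"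
  proof
    fix k
    have "bounded_monomial U (\<lambda>x. b x $ k)"
      using b by (simp add: bounded_monomial_map_def)
    from jet_bound_bounded_monomial[OF assms(1-3) this assms(5)]
    show "\<exists>A B. A > 0 \<and> B \<ge> 0 \<and>
      (\<forall>N. jet_bound V N (\<lambda>x. b (P_map \<alpha> x) $ k) (\<lambda>n. B * A ^ n * fact n powr (C + 1)))"
      unfolding V_def C_def by blast
  qed
  then obtain A' B' where A': "\<And>k. A' k > 0" and B': "\<And>k. B' k \<ge> 0"
    and jet': "\<And>k N. jet_bound V N (\<lambda>x. b (P_map \<alpha> x) $ k) (\<lambda>n. B' k * A' k ^ n * fact n powr (C + 1))"
    unfolding choice_iff by blast
  define A where "A = (\<Sum>k\<in>UNIV. A' k)"
  define B where "B = (\<Sum>k\<in>UNIV. B' k)"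
  have A: "A > 0" and B: "B \<ge> 0"
    unfolding A_def B_def using A' B' by (auto intro!: sum_pos sum_nonneg)
  have jet: "jet_bound V N (\<lambda>x. b (P_map \<alpha> x) $ k) (\<lambda>n. B * A ^ n * fact n powr (C + 1))" for k N
  proof (rule jet_bound_mono[OF jet' order_refl])
    have "A' k \<le> A" "B' k \<le> B"
      unfolding A_def B_def using A' B' by (auto intro!: member_le_sum simp: less_imp_le)
    then show "B' k * A' k ^ n * fact n powr (C + 1) \<le> B * A ^ n * fact n powr (C + 1)" for n
      using B A' by (intro mult_right_mono mult_mono power_mono) (auto simp: less_imp_le)
  qed
  define q where "q = A * (2 + 4 * real CARD('n) * L * B)"
  have "q > 0" using A B KL by (auto simp: q_def intro!: mult_pos_pos add_pos_nonneg)
  have "b (P_map \<alpha> x) \<in> closure (b ` U)" if "x \<in> V" for x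
    using that closure_subset[of "b ` U"] by (auto simp: V_def)
  from jet_bound_compose_analytic[OF V C A B KL F_deriv F_bound jet this q_def, of _ "[]"]
  have "jet_bound V N (\<lambda>x. F (b (P_map \<alpha> x))) (\<lambda>n. K * q ^ n * fact n powr (C + 1))" for N
    by (simp add: iter_partial_simps powr_add mult_ac)
  from jet_bound_mult_gevrey[OF V C less_imp_le[OF A] less_imp_le[OF \<open>q > 0\<close>] B KL(1) jet this]
  have "jet_bound V N (\<lambda>x. b (P_map \<alpha> x) $ j * F (b (P_map \<alpha> x)))
      (\<lambda>n. B * K * (A + q) ^ n * fact n powr (C + 1))" for N .
  \<comment> \<open>The constant in front has to be positive, but \<open>B * K\<close> may vanish.\<close>
  then have "jet_bound V N (\<lambda>x. b (P_map \<alpha> x) $ j * F (b (P_map \<alpha> x)))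
      (\<lambda>n. (B * K + 1) * (A + q) ^ n * fact n powr (C + 1))" for N
    by (rule jet_bound_mono) (use A \<open>q > 0\<close> in \<open>auto intro!: mult_right_mono\<close>)
  then have "jet_bound V N (f \<circ> P_map \<alpha>) (\<lambda>n. (B * K + 1) * (A + q) ^ n * fact n powr (C + 1))" for N
    by (rule jet_bound_cong[OF V, rotated]) (simp add: V_def f)
  then have "C_mild C V (f \<circ> P_map \<alpha>)"
    using A B KL \<open>q > 0\<close> C V
    by (intro C_mildI[where A = "A + q" and B = "B * K + 1"]) (auto simp: V_def intro: add_nonneg_pos)
  then show ?thesis unfolding V_def C_def .
qed

end
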